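(* Let $\mu$ and $\nu$ be two probability measures on the real line. Then there exist two unique probability measures $\zeta_1$ and $\zeta_2$ on the real line such that $$\mu\boxplus\nu=\mu\triangleright\zeta_1=\nu\triangleright\zeta_2=\zeta_1\uplus\zeta_2.$$
   Context: For a probability measure $\mu$ on $\mathbb{R}$ and $z\in\mathbb{C}^+=\{\mathrm{Im}\,z>0\}$ put $G_\mu(z)=\int_{\mathbb{R}}\frac{1}{z-x}\,\mathrm{d}\mu(x)$ and $F_\mu(z)=1/G_\mu(z)$. The map $\mu\mapsto F_\mu$ is a bijection from the probability measures on $\mathbb{R}$ onto the class $\mathcal{F}$ of holomorphic maps $F:\mathbb{C}^+\to\mathbb{C}^+$ with $\inf_{z\in\mathbb{C}^+}\mathrm{Im}F(z)/\mathrm{Im}z=1$. Additive free convolution $\boxplus$: it is known that for probability measures $\mu,\nu$ on $\mathbb{R}$ there exist unique functions $Z_1,Z_2\in\mathcal{F}$ with $F_\mu(Z_1(z))=F_\nu(Z_2(z))=Z_1(z)+Z_2(z)-z$ for all $z\in\mathbb{C}^+$, and that $F_\mu\circ Z_1\in\mathcal{F}$; $\mu\boxplus\nu$ is the probability measure with $F_{\mu\boxplus\nu}=F_\mu\circ Z_1=F_\nu\circ Z_2$. Additive monotone convolution $\triangleright$: $\mu\triangleright\nu$ is the probability measure with $F_{\mu\triangleright\nu}=F_\mu\circ F_\nu$. Additive boolean convolution $\uplus$: $\mu\uplus\nu$ is the probability measure with $F_{\mu\uplus\nu}(z)=F_\mu(z)+F_\nu(z)-z$ for $z\in\mathbb{C}^+$.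 *)

theory Defs
  imports "HOL-Probability.Probability"
begin

text \<open>
  A probability measure on the real line is a Borel probability measure, i.e. a measure
  satisfying the library predicate \<^const>\<open>real_distribution\<close>; in particular all such
  measures have the same sigma-algebra, so that HOL equality is equality of measures.
\<close>

definition upper_half_plane :: "complex set" where
  "upper_half_plane = {z. Im z > 0}"

definition cauchy_transform :: "real measure \<Rightarrow> complex \<Rightarrow> complex" where
  "cauchy_transform \<mu> z = (LINT x|\<mu>. 1 / (z - complex_of_real x))"

definition F_transform :: "real measure \<Rightarrow> complex \<Rightarrow> complex" where
  "F_transform \<mu> z = 1 / cauchy_transform \<mu> z"

text \<open>
  Maps on the upper half-plane are total HOL functions whose values elsewhere are irrelevant.
  The infimum below is over a nonempty set of positive reals, so the real-valued \<^const>\<open>Inf\<close>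
  is the usual infimum.
\<close>

definition F_class :: "(complex \<Rightarrow> complex) set" where
  "F_class = {F. F holomorphic_on upper_half_plane \<and>
                 F ` upper_half_plane \<subseteq> upper_half_plane \<and>
                 (INF z\<in>upper_half_plane. Im (F z) / Im z) = 1}"

definition subordination_functions ::
  "real measure \<Rightarrow> real measure \<Rightarrow> (complex \<Rightarrow> complex) \<Rightarrow> (complex \<Rightarrow> complex) \<Rightarrow> bool" where
  "subordination_functions \<mu> \<nu> Z1 Z2 \<longleftrightarrow>
     Z1 \<in> F_class \<and> Z2 \<in> F_class \<and>
     (\<forall>z\<in>upper_half_plane.
        F_transform \<mu> (Z1 z) = F_transform \<nu> (Z2 z) \<and>
        F_transform \<nu> (Z2 z) = Z1 z + Z2 z - z)"

text \<open>
  A probability measure is determined by its F-transform on the upper half-plane; each of the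
  three convolutions is the unique probability measure with the prescribed F-transform.
\<close>

definition free_convolution :: "real measure \<Rightarrow> real measure \<Rightarrow> real measure" where
  "free_convolution \<mu> \<nu> = (THE \<rho>. real_distribution \<rho> \<and>
     (\<exists>Z1 Z2. subordination_functions \<mu> \<nu> Z1 Z2 \<and>
        (\<forall>z\<in>upper_half_plane.
           F_transform \<rho> z = F_transform \<mu> (Z1 z) \<and>
           F_transform \<rho> z = F_transform \<nu> (Z2 z))))"

definition monotone_convolution :: "real measure \<Rightarrow> real measure \<Rightarrow> real measure" where
  "monotone_convolution \<mu> \<nu> = (THE \<rho>. real_distribution \<rho> \<and>
     (\<forall>z\<in>upper_half_plane. F_transform \<rho> z = F_transform \<mu> (F_transform \<nu> z)))"

definition boolean_convolution :: "real measure \<Rightarrow> real measure \<Rightarrow> real measure" where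
  "boolean_convolution \<mu> \<nu> = (THE \<rho>. real_distribution \<rho> \<and>
     (\<forall>z\<in>upper_half_plane. F_transform \<rho> z = F_transform \<mu> z + F_transform \<nu> z - z))"

end

theory Submission
  imports Defs "HOL-Complex_Analysis.Complex_Analysis"
begin

text \<open>
  Write \<open>F\<^sub>\<mu> = id + h\<^sub>1\<close> and \<open>F\<^sub>\<nu> = id + h\<^sub>2\<close>.  The functions \<open>h\<^sub>i\<close> map the upper half-plane into its closure
  (Pick functions) and satisfy \<open>inf Im h\<^sub>i / Im = 0\<close>; this describes the class of all reciprocal Cauchy
  transforms.  On the level of these transforms the three equations between the convolutions say
  exactly that \<open>Z\<^sub>1 = F\<^sub>\<zeta>\<^sub>1\<close> and \<open>Z\<^sub>2 = F\<^sub>\<zeta>\<^sub>2\<close> solve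
  \<open>Z\<^sub>1 = z + h\<^sub>2(Z\<^sub>2)\<close>, \<open>Z\<^sub>2 = z + h\<^sub>1(Z\<^sub>1)\<close>, i.e. that they are the subordination functions of \<open>\<mu>\<close> and \<open>\<nu>\<close>.
  So the claim reduces to two facts: the subordination functions exist, are unique and lie in the
  class; and a measure is the same thing as a member of the class.

  The first fact rests on the Schwarz-Pick inequality (\<open>schwarz_pick\<close>).  For two solutions at
  the same \<open>z\<close> it gives a contraction factor below 1, because \<open>Im h\<^sub>2(Z\<^sub>2) = Im Z\<^sub>1 - Im z < Im Z\<^sub>1\<close> and
  symmetrically; hence uniqueness, and with a little more care local Lipschitz continuity and
  differentiability in \<open>z\<close>.  For existence, \<open>Z\<^sub>1\<close> has to be a fixed point of
  \<open>g(w) = z + h\<^sub>2(z + h\<^sub>1(w))\<close>.  A self-map of the half-plane whose imaginary part is bounded away from 0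
  has a fixed point as soon as it lowers the imaginary part of a single point: composing it with
  Moebius maps into horodisks makes Brouwer's theorem applicable, and Schwarz-Pick against that
  single point keeps the approximate fixed points bounded (\<open>fixed_point_of_half_plane_map\<close>).  The
  map \<open>g\<close> lowers \<open>Im\<close> far up the imaginary axis, because \<open>h(v(iy)) / y\<close> tends to 0 whenever
  \<open>inf Im h / Im = 0\<close>, for every Pick function \<open>v\<close> staying away from the real line along the axis
  (\<open>pick_comp_sublinear\<close>).  The same limit shows that the class is closed under composition and
  contains the subordination functions.

  For the second fact, injectivity follows by multiplying characteristic functions: up to the
  factor \<open>- 1/\<pi>\<close>, the imaginary part of the Cauchy transform on the line \<open>Im = y\<close> is the density of the convolution with a Cauchy
  distribution (\<open>char_times_cauchy\<close>).  For surjectivity, put \<open>G = 1/F\<close>; the Poisson formula for the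
  half-plane shows that \<open>- Im G(t + i\<epsilon>)/\<pi>\<close> is a probability density whose Cauchy transform is
  \<open>G(z + i\<epsilon>)\<close>, these measures are tight, and a weak limit as \<open>\<epsilon>\<close> tends to 0 has Cauchy transform \<open>G\<close>.
\<close>

section \<open>Pick functions on the upper half-plane\<close>

lemma upper_half_plane_iff: "z \<in> upper_half_plane \<longleftrightarrow> Im z > 0"
  by (simp add: upper_half_plane_def)

lemma open_upper_half_plane: "open upper_half_plane"
  unfolding upper_half_plane_def by (rule open_halfspace_Im_gt)

definition pick_function :: "(complex \<Rightarrow> complex) \<Rightarrow> bool" where
  "pick_function h \<longleftrightarrow> h holomorphic_on upper_half_plane \<and> (\<forall>z\<in>upper_half_plane. Im (h z) \<ge> 0)"

text \<open>
  For a Pick function this is \<open>inf Im h / Im = 0\<close>, and it amounts to a vanishing linear coefficient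
  in the Nevanlinna representation, hence the name.
\<close>

definition sublinear :: "(complex \<Rightarrow> complex) \<Rightarrow> bool" where
  "sublinear h \<longleftrightarrow> (\<forall>\<delta>>0. \<exists>p\<in>upper_half_plane. Im (h p) \<le> \<delta> * Im p)"

text \<open>
  The identity expresses the pseudohyperbolic distance \<open>\<bar>p - q\<bar> / \<bar>p - cnj q\<bar>\<close> through the quotient
  \<open>\<bar>p - q\<bar>\<^sup>2 / (Im p Im q)\<close>, which is more convenient for estimates.
\<close>

lemma norm_diff_cnj_squared: "(cmod (p - cnj q))\<^sup>2 = (cmod (p - q))\<^sup>2 + 4 * (Im p * Im q)"
  unfolding cmod_power2 by (simp add: power2_eq_square algebra_simps)

lemma closer_to_point_than_cnj_iff:
  assumes "Im a > 0"
  shows "cmod (w - a) < cmod (w - cnj a) \<longleftrightarrow> Im w > 0"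
proof -
  have "cmod (w - a) < cmod (w - cnj a) \<longleftrightarrow> (cmod (w - a))\<^sup>2 < (cmod (w - cnj a))\<^sup>2"
    by (metis norm_ge_zero pos2 power_less_imp_less_base power_strict_mono)
  also have "\<dots> \<longleftrightarrow> Im w > 0"
    unfolding norm_diff_cnj_squared using assms by (simp add: zero_less_mult_iff)
  finally show ?thesis .
qed

text \<open>
  The Schwarz lemma applies to \<open>h\<close> conjugated by the Cayley maps that send \<open>w2\<close> and \<open>h w2\<close> to 0.
\<close>

lemma schwarz_pick_strict:
  assumes hol: "h holomorphic_on upper_half_plane"
    and pos: "\<And>z. Im z > 0 \<Longrightarrow> Im (h z) > 0"
    and w1: "Im w1 > 0" and w2: "Im w2 > 0"
  shows "(cmod (h w1 - h w2))\<^sup>2 * (Im w1 * Im w2) \<le> (cmod (w1 - w2))\<^sup>2 * (Im (h w1) * Im (h w2))"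
proof -
  define b where "b = h w2"
  have b: "Im b > 0" using pos w2 by (simp add: b_def)
  have ne_cnj: "w \<noteq> cnj a" if "Im w > 0" "Im a > 0" for w a
    using that by (metis cnj.simps(2) neg_0_less_iff_less not_less_iff_gr_or_eq)
  define \<psi> where "\<psi> = (\<lambda>\<zeta>. (w2 - cnj w2 * \<zeta>) / (1 - \<zeta>))"
  have \<psi>: "Im (\<psi> \<zeta>) > 0" if "cmod \<zeta> < 1" for \<zeta>
  proof -
    have z1: "1 - \<zeta> \<noteq> 0" using that by auto
    have "\<psi> \<zeta> - w2 = \<zeta> * ((w2 - cnj w2) / (1 - \<zeta>))" and *: "\<psi> \<zeta> - cnj w2 = (w2 - cnj w2) / (1 - \<zeta>)"
      using z1 by (simp_all add: \<psi>_def divide_simps) (simp_all add: algebra_simps)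
    then have "cmod (\<psi> \<zeta> - w2) = cmod \<zeta> * cmod (\<psi> \<zeta> - cnj w2)"
      by (simp only: norm_mult)
    moreover have "\<psi> \<zeta> - cnj w2 \<noteq> 0"
      unfolding * using ne_cnj[OF w2 w2] z1 by simp
    ultimately have "cmod (\<psi> \<zeta> - w2) < cmod (\<psi> \<zeta> - cnj w2)" using that by simp
    then show ?thesis using closer_to_point_than_cnj_iff[OF w2] by simp
  qed
  define f where "f = (\<lambda>\<zeta>. (h (\<psi> \<zeta>) - b) / (h (\<psi> \<zeta>) - cnj b))"
  have hol_\<psi>: "\<psi> holomorphic_on ball 0 1"
    unfolding \<psi>_def by (intro holomorphic_intros) auto
  have hol_h\<psi>: "(\<lambda>\<zeta>. h (\<psi> \<zeta>)) holomorphic_on ball 0 1"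
    using holomorphic_on_compose_gen[OF hol_\<psi> hol] \<psi>
    by (simp add: o_def upper_half_plane_iff image_subset_iff)
  have holf: "f holomorphic_on ball 0 1"
    unfolding f_def using ne_cnj[OF pos[OF \<psi>] b]
    by (intro holomorphic_intros hol_h\<psi>) auto
  have f0: "f 0 = 0" by (simp add: f_def \<psi>_def b_def)
  have f1: "cmod (f \<zeta>) < 1" if "cmod \<zeta> < 1" for \<zeta>
    using closer_to_point_than_cnj_iff[OF b, of "h (\<psi> \<zeta>)"] pos[OF \<psi>[OF that]] ne_cnj[OF pos[OF \<psi>[OF that]] b]
    by (simp add: f_def norm_divide)
  define \<xi> where "\<xi> = (w1 - w2) / (w1 - cnj w2)"
  have d: "w1 - cnj w2 \<noteq> 0" using ne_cnj[OF w1 w2] by simp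
  have \<xi>: "cmod \<xi> < 1"
    using closer_to_point_than_cnj_iff[OF w2, of w1] w1 d by (simp add: \<xi>_def norm_divide)
  have "\<psi> \<xi> = w1"
  proof -
    have "1 - \<xi> = (w2 - cnj w2) / (w1 - cnj w2)"
      "w2 - cnj w2 * \<xi> = w1 * (w2 - cnj w2) / (w1 - cnj w2)"
      using d by (simp_all add: \<xi>_def divide_simps) (simp_all add: algebra_simps)
    then show ?thesis using d ne_cnj[OF w2 w2] by (simp add: \<psi>_def)
  qed
  then have "cmod (h w1 - b) / cmod (h w1 - cnj b) \<le> cmod (w1 - w2) / cmod (w1 - cnj w2)"
    using Schwarz_Lemma(1)[OF holf f0 f1 \<xi>] by (simp add: f_def \<xi>_def norm_divide)
  moreover have "h w1 - cnj b \<noteq> 0" using ne_cnj[OF pos[OF w1] b] by simp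
  ultimately have "cmod (h w1 - b) * cmod (w1 - cnj w2) \<le> cmod (w1 - w2) * cmod (h w1 - cnj b)"
    using d by (simp add: field_simps)
  then have "(cmod (h w1 - b))\<^sup>2 * (cmod (w1 - cnj w2))\<^sup>2 \<le> (cmod (w1 - w2))\<^sup>2 * (cmod (h w1 - cnj b))\<^sup>2"
    by (metis mult_nonneg_nonneg norm_ge_zero power_mono power_mult_distrib)
  then show ?thesis
    unfolding norm_diff_cnj_squared b_def by (simp add: algebra_simps)
qed

text \<open>
  Adding \<open>i\<epsilon>\<close> makes the strict form applicable, and the inequality survives \<open>\<epsilon> \<rightarrow> 0\<close>.  Writing it
  without quotients lets it include the real constants.
\<close>

lemma schwarz_pick:
  assumes h: "pick_function h" and w1: "Im w1 > 0" and w2: "Im w2 > 0"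
  shows "(cmod (h w1 - h w2))\<^sup>2 * (Im w1 * Im w2) \<le> (cmod (w1 - w2))\<^sup>2 * (Im (h w1) * Im (h w2))"
proof (rule tendsto_lowerbound)
  let ?r = "\<lambda>\<epsilon>. (cmod (w1 - w2))\<^sup>2 * ((Im (h w1) + \<epsilon>) * (Im (h w2) + \<epsilon>))"
  show "(?r \<longlongrightarrow> (cmod (w1 - w2))\<^sup>2 * (Im (h w1) * Im (h w2))) (at_right 0)"
    by (auto intro!: tendsto_eq_intros)
  have "(cmod (h w1 - h w2))\<^sup>2 * (Im w1 * Im w2) \<le> ?r \<epsilon>" if "\<epsilon> > 0" for \<epsilon> :: real
  proof -
    have "Im (h z + \<i> * \<epsilon>) > 0" if "Im z > 0" for z
      using h that \<open>\<epsilon> > 0\<close> by (auto simp: pick_function_def upper_half_plane_iff intro: add_nonneg_pos)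
    moreover have "(\<lambda>z. h z + \<i> * \<epsilon>) holomorphic_on upper_half_plane"
      using h by (auto simp: pick_function_def intro!: holomorphic_intros)
    ultimately show ?thesis
      using schwarz_pick_strict[of "\<lambda>z. h z + \<i> * \<epsilon>", OF _ _ w1 w2] by simp
  qed
  then show "eventually (\<lambda>\<epsilon>. (cmod (h w1 - h w2))\<^sup>2 * (Im w1 * Im w2) \<le> ?r \<epsilon>) (at_right 0)"
    by (auto simp: eventually_at_right_less intro!: eventually_at_rightI[of 0 1])
qed simp

text \<open>
  A quantitative Julia lemma: the angular behaviour of \<open>h\<close> at infinity is controlled by the single
  ratio \<open>Im (h p) / Im p\<close>, which is small for suitable \<open>p\<close> if \<open>h\<close> is sublinear.  In terms of
  \<open>t = \<bar>h w - h p\<bar>\<close>, Schwarz-Pick yields \<open>t\<^sup>2 \<le> X (t + \<bar>h p\<bar>)\<close>,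
  where \<open>X\<close> is the last term of the bound, and this forces \<open>t \<le> X + \<bar>h p\<bar>\<close>.
\<close>

lemma pick_growth:
  assumes h: "pick_function h" and w: "Im w > 0" and p: "Im p > 0"
  shows "cmod (h w) \<le> 2 * cmod (h p) + (cmod (w - p))\<^sup>2 / Im w * (Im (h p) / Im p)"
proof -
  define t where "t = cmod (h w - h p)"
  define c where "c = cmod (h p)"
  define X where "X = (cmod (w - p))\<^sup>2 / Im w * (Im (h p) / Im p)"
  have hp: "Im (h p) \<ge> 0" using h p by (auto simp: pick_function_def upper_half_plane_iff)
  have X: "X \<ge> 0" using w p hp by (simp add: X_def)
  have tri: "cmod (h w) \<le> t + c" unfolding t_def c_def by norm
  have "t\<^sup>2 * (Im w * Im p) \<le> (cmod (w - p))\<^sup>2 * (Im (h w) * Im (h p))"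
    using schwarz_pick[OF h w p] by (simp add: t_def)
  then have "t\<^sup>2 \<le> X * Im (h w)"
    using w p by (simp add: X_def field_simps)
  also have "\<dots> \<le> X * (t + c)"
    using tri abs_Im_le_cmod[of "h w"] X by (intro mult_left_mono) auto
  finally have sq: "t\<^sup>2 \<le> X * (t + c)" .
  have "t \<le> X + c"
  proof (rule ccontr)
    assume "\<not> t \<le> X + c"
    then have gt: "t > X + c" by simp
    have c0: "c \<ge> 0" by (simp add: c_def)
    have "X * (t + c) = X * t + c * X" by (simp add: algebra_simps)
    also have "\<dots> \<le> X * t + c * t" using gt X c0 by (intro add_left_mono mult_left_mono) auto
    also have "\<dots> = (X + c) * t" by (simp add: algebra_simps)
    also have "\<dots> < t * t" using gt X c0 by (intro mult_strict_right_mono) auto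
    finally show False using sq by (simp add: power2_eq_square)
  qed
  then show ?thesis using tri by (simp add: X_def c_def)
qed

text \<open>
  The point of this estimate is that \<open>v(iy)\<close> need not approach infinity nontangentially.  Comparing
  \<open>v(iy)\<close> with \<open>v(i)\<close> by Schwarz-Pick yields \<open>\<bar>v(iy)\<bar>\<^sup>2 \<le> M y Im v(iy)\<close>, and the quotient
  \<open>\<bar>v(iy)\<bar>\<^sup>2 / Im v(iy)\<close> is all that enters the growth bound for \<open>h\<close>.
\<close>

lemma pick_comp_sublinear:
  assumes h: "pick_function h" "sublinear h" and v: "pick_function v"
    and c: "c > 0" "\<And>y. y \<ge> 1 \<Longrightarrow> Im (v (\<i> * of_real y)) \<ge> c"
  shows "((\<lambda>y. h (v (\<i> * of_real y)) / of_real y) \<longlongrightarrow> 0) at_top"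
proof -
  define B where "B = cmod (v \<i>)"
  define M where "M = 2 * B + 2 * B\<^sup>2 / c"
  have B: "B \<ge> 0" by (simp add: B_def)
  have M: "M \<ge> 0" using B c by (simp add: M_def)
  have vM: "(cmod (v (\<i> * of_real y)))\<^sup>2 \<le> M * y * Im (v (\<i> * of_real y))" if y: "y \<ge> 1" for y :: real
  proof -
    let ?v = "v (\<i> * of_real y)"
    have Iv: "Im ?v \<ge> c" "Im ?v > 0" using c y by (force)+
    have "(cmod (?v - v \<i>))\<^sup>2 * y \<le> (cmod (\<i> * of_real y - \<i>))\<^sup>2 * (Im ?v * Im (v \<i>))"
      using schwarz_pick[OF v, of "\<i> * of_real y" \<i>] y by simp
    also have "cmod (\<i> * of_real y - \<i>) = y - 1"
    proof -
      have "\<i> * of_real y - \<i> = \<i> * of_real (y - 1)" by (simp add: algebra_simps)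
      then show ?thesis using y by (simp add: norm_mult del: of_real_diff)
    qed
    also have "(y - 1)\<^sup>2 * (Im ?v * Im (v \<i>)) \<le> y\<^sup>2 * (Im ?v * B)"
      using y Iv abs_Im_le_cmod[of "v \<i>"] c(2)[of 1] c(1)
      by (intro mult_mono power_mono) (auto simp: B_def)
    finally have 1: "(cmod (?v - v \<i>))\<^sup>2 \<le> y * (Im ?v * B)"
      using y by (simp add: power2_eq_square)
    have 2: "B\<^sup>2 \<le> B\<^sup>2 / c * y * Im ?v"
    proof -
      have "B\<^sup>2 = B\<^sup>2 / c * 1 * c" using c by simp
      also have "\<dots> \<le> B\<^sup>2 / c * y * Im ?v" using c y Iv by (intro mult_mono) auto
      finally show ?thesis .
    qed
    have "(cmod ?v)\<^sup>2 \<le> (cmod (?v - v \<i>) + B)\<^sup>2"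
      unfolding B_def by (intro power_mono) norm+
    also have "\<dots> \<le> 2 * (cmod (?v - v \<i>))\<^sup>2 + 2 * B\<^sup>2"
      using sum_squares_bound[of "cmod (?v - v \<i>)" B] by (simp add: power2_sum)
    also have "\<dots> \<le> M * y * Im ?v"
    proof -
      have "M * y * Im ?v = 2 * (y * (Im ?v * B)) + 2 * (B\<^sup>2 / c * y * Im ?v)"
        by (simp add: M_def algebra_simps)
      then show ?thesis using 1 2 by linarith
    qed
    finally show ?thesis .
  qed
  show ?thesis
  proof (rule tendstoI)
    fix e :: real assume e: "e > 0"
    define \<delta> where "\<delta> = e / (4 * M + 4)"
    have \<delta>: "\<delta> > 0" using e M by (simp add: \<delta>_def)
    obtain p where p: "Im p > 0" "Im (h p) \<le> \<delta> * Im p"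
      using h(2) \<delta> by (auto simp: sublinear_def upper_half_plane_iff)
    define C where "C = 2 * cmod (h p) + 2 * \<delta> * (cmod p)\<^sup>2 / c"
    have ev: "eventually (\<lambda>y::real. C / y < e / 2) at_top"
      by (rule order_tendstoD(2)[OF tendsto_divide_0[OF tendsto_const
              filterlim_at_top_imp_at_infinity[OF filterlim_ident]]]) (use e in simp)
    show "eventually (\<lambda>y. dist (h (v (\<i> * of_real y)) / of_real y) 0 < e) at_top"
      using ev eventually_ge_at_top[of 1]
    proof eventually_elim
      case (elim y)
      let ?v = "v (\<i> * of_real y)"
      have y: "y \<ge> 1" and y0: "y > 0" using elim by auto
      have Iv: "Im ?v \<ge> c" "Im ?v > 0" using c y by (force)+
      have "(cmod (?v - p))\<^sup>2 \<le> (cmod ?v + cmod p)\<^sup>2"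
        by (intro power_mono norm_triangle_ineq4) simp
      also have "\<dots> \<le> 2 * (cmod ?v)\<^sup>2 + 2 * (cmod p)\<^sup>2"
        using sum_squares_bound[of "cmod ?v" "cmod p"] by (simp add: power2_sum)
      also have "\<dots> \<le> 2 * (M * y * Im ?v) + 2 * (cmod p)\<^sup>2" using vM[OF y] by simp
      finally have "(cmod (?v - p))\<^sup>2 / Im ?v \<le> (2 * (M * y * Im ?v) + 2 * (cmod p)\<^sup>2) / Im ?v"
        using Iv by (intro divide_right_mono) auto
      also have "\<dots> = 2 * M * y + 2 * (cmod p)\<^sup>2 / Im ?v" using Iv by (simp add: field_simps)
      also have "\<dots> \<le> 2 * M * y + 2 * (cmod p)\<^sup>2 / c"
        using Iv c by (intro add_left_mono divide_left_mono) auto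
      finally have a: "(cmod (?v - p))\<^sup>2 / Im ?v \<le> 2 * M * y + 2 * (cmod p)\<^sup>2 / c" .
      have hp0: "Im (h p) \<ge> 0" using h p by (auto simp: pick_function_def upper_half_plane_iff)
      have "cmod (h ?v) \<le> 2 * cmod (h p) + (cmod (?v - p))\<^sup>2 / Im ?v * (Im (h p) / Im p)"
        by (rule pick_growth) (use h p Iv in auto)
      also have "\<dots> \<le> 2 * cmod (h p) + (2 * M * y + 2 * (cmod p)\<^sup>2 / c) * \<delta>"
        using a p hp0 Iv M y0 c \<delta>
        by (intro add_left_mono mult_mono) (auto simp: field_simps)
      also have "\<dots> = C + (2 * M * \<delta>) * y" by (simp add: C_def algebra_simps)
      also have "\<dots> \<le> C + e / 2 * y"
      proof -
        have "2 * M * \<delta> \<le> e / 2" using e M by (simp add: \<delta>_def field_simps)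
        then show ?thesis using y0 by (intro add_left_mono mult_right_mono) auto
      qed
      finally have "cmod (h ?v) / y \<le> C / y + e / 2" using y0 by (simp add: field_simps)
      also have "\<dots> < e" using elim(1) by linarith
      finally show ?case using y0 by (simp add: norm_divide)
    qed
  qed
qed

section \<open>Fixed points of maps of the half-plane\<close>

text \<open>
  A form of Wolff's theorem: if \<open>g\<close> had no fixed point, its iterates would escape to infinity and
  all half-planes \<open>Im w > a\<close> would be invariant, contrary to the behaviour of \<open>g\<close> at \<open>w0\<close>.  The proof
  avoids iteration.  The Moebius map \<open>\<phi>\<^sub>\<epsilon>(w) = w / (1 - i\<epsilon>w)\<close> sends the half-plane into a disk of
  diameter \<open>1/\<epsilon>\<close> tangent to the real line at 0, so \<open>\<phi>\<^sub>\<epsilon> \<circ> g\<close> maps a compact convex set into itself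
  and has a fixed point \<open>u\<^sub>\<epsilon>\<close>.  Schwarz-Pick for the pair \<open>w0\<close>, \<open>u\<^sub>\<epsilon>\<close> would turn into
  \<open>Im w0 \<le> Im (g w0)\<close> if \<open>u\<^sub>\<epsilon>\<close> were unbounded as \<open>\<epsilon> \<rightarrow> 0\<close>, so the \<open>u\<^sub>\<epsilon>\<close> accumulate at a fixed point of \<open>g\<close>.
\<close>

lemma fixed_point_of_half_plane_map:
  assumes hol: "g holomorphic_on upper_half_plane"
    and c: "c > 0" "\<And>w. Im w > 0 \<Longrightarrow> Im (g w) \<ge> c"
    and w0: "Im w0 > 0" "Im (g w0) < Im w0"
  shows "\<exists>w. Im w > 0 \<and> g w = w"
proof -
  \<comment> \<open>The bound \<open>e n * c \<le> 1/2\<close> keeps the images under \<open>\<phi>\<close> above the line \<open>Im = c/2\<close>.\<close>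
  define e where "e = (\<lambda>n::nat. 1 / (2 * c * real (Suc n)))"
  define \<phi> where "\<phi> = (\<lambda>(\<epsilon>::real) w. w / (1 - \<i> * of_real \<epsilon> * w))"
  have e: "e n > 0" "e n * c \<le> 1 / 2" for n
  proof -
    show "e n > 0" using c by (simp add: e_def)
    have "c \<noteq> 0" using c by simp
    then have "e n * c = 1 / (2 * real (Suc n))" by (simp add: e_def)
    also have "\<dots> \<le> 1 / 2" by (simp add: divide_simps)
    finally show "e n * c \<le> 1 / 2" .
  qed
  have e0: "e \<longlonglongrightarrow> 0"
  proof -
    have "(\<lambda>n. 1 / (2 * c) * (1 / real (Suc n))) \<longlonglongrightarrow> 1 / (2 * c) * 0"
      by (intro tendsto_intros LIMSEQ_Suc lim_1_over_n)
    then show ?thesis by (simp add: e_def divide_simps)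
  qed
  have den: "(cmod (1 - \<i> * of_real \<epsilon> * w))\<^sup>2 = 1 + 2 * \<epsilon> * Im w + \<epsilon>\<^sup>2 * (cmod w)\<^sup>2" for \<epsilon> w
    unfolding cmod_power2 by (simp add: power2_eq_square algebra_simps)
  have den_pos: "(cmod (1 - \<i> * of_real \<epsilon> * w))\<^sup>2 > 0" if "\<epsilon> > 0" "Im w > 0" for \<epsilon> w
    unfolding den using that by (intro add_pos_nonneg) auto
  have Im_\<phi>: "Im (\<phi> \<epsilon> w) = (Im w + \<epsilon> * (cmod w)\<^sup>2) / (cmod (1 - \<i> * of_real \<epsilon> * w))\<^sup>2" for \<epsilon> w
    unfolding \<phi>_def Im_divide' cmod_power2 by (simp add: power2_eq_square algebra_simps)
  have \<phi>_low: "Im (\<phi> (e n) w) \<ge> c / 2" if w: "Im w \<ge> c" for n w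
  proof -
    have w0: "Im w > 0" using w c by simp
    have "c / 2 * (1 + 2 * e n * Im w + (e n)\<^sup>2 * (cmod w)\<^sup>2)
        = c / 2 + (e n * c) * Im w + (e n * c) / 2 * (e n * (cmod w)\<^sup>2)"
      by (simp add: algebra_simps power2_eq_square)
    also have "\<dots> \<le> Im w / 2 + 1 / 2 * Im w + 1 * (e n * (cmod w)\<^sup>2)"
      using w w0 e[of n] by (intro add_mono mult_right_mono) auto
    finally show ?thesis
      unfolding Im_\<phi> using den_pos[OF e(1)[of n] w0] by (simp add: den pos_le_divide_eq)
  qed
  have \<phi>_bound: "cmod (\<phi> (e n) w) \<le> 1 / e n" if w: "Im w > 0" for n w
  proof -
    have "(e n * cmod w)\<^sup>2 \<le> (cmod (1 - \<i> * of_real (e n) * w))\<^sup>2"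
      unfolding den using w e(1)[of n] by (simp add: power_mult_distrib)
    then have "e n * cmod w \<le> cmod (1 - \<i> * of_real (e n) * w)"
      by (rule power2_le_imp_le) simp
    moreover have "cmod (1 - \<i> * of_real (e n) * w) > 0"
      using den_pos[OF e(1)[of n] w] by simp
    ultimately show ?thesis
      using e(1)[of n] by (simp add: \<phi>_def norm_divide field_simps)
  qed
  have hol_n: "(\<lambda>w. \<phi> (e n) (g w)) holomorphic_on upper_half_plane" for n
    unfolding \<phi>_def
  proof (intro holomorphic_intros hol)
    fix z assume "z \<in> upper_half_plane"
    then have "Im (g z) > 0" using c by (force simp: upper_half_plane_iff)
    from den_pos[OF e(1)[of n] this] show "1 - \<i> * of_real (e n) * g z \<noteq> 0" by auto
  qed
  have pick_n: "pick_function (\<lambda>w. \<phi> (e n) (g w))" for n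
  proof -
    have "Im (\<phi> (e n) (g w)) \<ge> 0" if "Im w > 0" for w
      using \<phi>_low[OF c(2)[OF that], of n] c(1) by linarith
    then show ?thesis using hol_n by (simp add: pick_function_def upper_half_plane_iff)
  qed
  define K where "K = (\<lambda>n. {w. Im w \<ge> c / 2} \<inter> cball 0 (1 / e n))"
  have "\<exists>u. u \<in> K n \<and> \<phi> (e n) (g u) = u" for n
  proof -
    have "compact (K n)" unfolding K_def
      by (intro closed_Int_compact closed_halfspace_Im_ge) auto
    moreover have "convex (K n)" unfolding K_def
      by (intro convex_Int convex_halfspace_Im_ge) auto
    moreover have "\<i> * of_real c \<in> K n"
      using c e[of n] by (auto simp: K_def norm_mult field_simps)
    moreover have "K n \<subseteq> upper_half_plane" using c by (auto simp: K_def upper_half_plane_iff)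
    then have "continuous_on (K n) (\<lambda>w. \<phi> (e n) (g w))"
      using hol_n holomorphic_on_imp_continuous_on holomorphic_on_subset by blast
    moreover have "(\<lambda>w. \<phi> (e n) (g w)) \<in> K n \<rightarrow> K n"
    proof
      fix w assume "w \<in> K n"
      then have "Im w > 0" using c by (auto simp: K_def)
      then have "Im (g w) \<ge> c" "Im (g w) > 0" using c(1) c(2)[of w] by auto
      then show "\<phi> (e n) (g w) \<in> K n" using \<phi>_low \<phi>_bound by (auto simp: K_def)
    qed
    ultimately show ?thesis using brouwer[of "K n" "\<lambda>w. \<phi> (e n) (g w)"] by (metis empty_iff)
  qed
  then obtain u where u: "\<And>n. u n \<in> K n" and fix_u: "\<And>n. \<phi> (e n) (g (u n)) = u n" by metis
  have u_low: "Im (u n) \<ge> c / 2" "Im (u n) > 0" for n using u[of n] c by (auto simp: K_def)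
  have \<phi>_lim: "(\<lambda>n. \<phi> (e (r n)) (s n)) \<longlonglongrightarrow> l"
    if "(\<lambda>n. e (r n)) \<longlonglongrightarrow> 0" "s \<longlonglongrightarrow> l" for r :: "nat \<Rightarrow> nat" and s l
    unfolding \<phi>_def using that by (auto intro!: tendsto_eq_intros)
  define A where "A = Im w0"
  define B where "B = (Im w0 + Im (g w0)) / 2"
  define C where "C = cmod (g w0) + 1"
  have gw0: "Im (g w0) > 0" using c w0 by force
  have AB: "0 < B" "B < A" using w0 gw0 by (auto simp: A_def B_def)
  have lim0: "(\<lambda>n. \<phi> (e n) (g w0)) \<longlonglongrightarrow> g w0" using \<phi>_lim[of "\<lambda>n. n" "\<lambda>_. g w0"] e0 by simp
  have "eventually (\<lambda>n. Im (\<phi> (e n) (g w0)) < B) sequentially"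
    by (rule order_tendstoD(2)[OF tendsto_Im[OF lim0]]) (use w0 in \<open>simp add: B_def\<close>)
  moreover have "eventually (\<lambda>n. cmod (\<phi> (e n) (g w0)) < C) sequentially"
    by (rule order_tendstoD(2)[OF tendsto_norm[OF lim0]]) (simp add: C_def)
  ultimately have "eventually (\<lambda>n. Im (\<phi> (e n) (g w0)) < B \<and> cmod (\<phi> (e n) (g w0)) < C) sequentially"
    by eventually_elim simp
  then obtain N where N: "\<And>n. n \<ge> N \<Longrightarrow> Im (\<phi> (e n) (g w0)) < B \<and> cmod (\<phi> (e n) (g w0)) < C"
    by (auto simp: eventually_sequentially)
  \<comment> \<open>Schwarz-Pick gives \<open>(t - C) sqrt A \<le> (\<bar>w0\<bar> + t) sqrt B\<close> for \<open>t = \<bar>u n\<bar>\<close>; \<open>R\<close> is the resulting bound.\<close>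
  define R where "R = (C * sqrt A + cmod w0 * sqrt B) / (sqrt A - sqrt B)"
  have u_bound: "cmod (u n) \<le> R" if n: "n \<ge> N" for n
  proof -
    define q where "q = \<phi> (e n) (g w0)"
    have q: "Im q < B" "cmod q < C" using N[OF n] by (auto simp: q_def)
    have "(cmod (q - u n))\<^sup>2 * (A * Im (u n)) \<le> (cmod (w0 - u n))\<^sup>2 * (Im q * Im (u n))"
      using schwarz_pick[OF pick_n[of n] w0(1) u_low(2)[of n]] fix_u[of n] by (simp add: q_def A_def)
    then have "(cmod (q - u n))\<^sup>2 * A \<le> (cmod (w0 - u n))\<^sup>2 * Im q"
      using u_low(2)[of n] by (simp add: mult.assoc[symmetric])
    also have "\<dots> \<le> (cmod (w0 - u n))\<^sup>2 * B" using q by (intro mult_left_mono) auto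
    finally have "sqrt ((cmod (q - u n))\<^sup>2 * A) \<le> sqrt ((cmod (w0 - u n))\<^sup>2 * B)" by simp
    then have 1: "cmod (q - u n) * sqrt A \<le> cmod (w0 - u n) * sqrt B"
      by (simp add: real_sqrt_mult)
    have "(cmod (u n) - C) * sqrt A \<le> cmod (q - u n) * sqrt A"
      using q AB norm_triangle_ineq2[of "u n" q] by (intro mult_right_mono) (auto simp: norm_minus_commute)
    also note 1
    also have "cmod (w0 - u n) * sqrt B \<le> (cmod w0 + cmod (u n)) * sqrt B"
      using AB by (intro mult_right_mono norm_triangle_ineq4) auto
    finally have "cmod (u n) * (sqrt A - sqrt B) \<le> C * sqrt A + cmod w0 * sqrt B"
      by (simp add: algebra_simps)
    moreover have "sqrt A - sqrt B > 0" using AB by simp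
    ultimately show ?thesis by (simp add: R_def pos_le_divide_eq)
  qed
  have "compact ({w. Im w \<ge> c / 2} \<inter> cball 0 R)"
    by (intro closed_Int_compact closed_halfspace_Im_ge) auto
  moreover have "\<forall>n. u (n + N) \<in> {w. Im w \<ge> c / 2} \<inter> cball 0 R"
    using u_low u_bound by auto
  ultimately obtain l r where l: "l \<in> {w. Im w \<ge> c / 2} \<inter> cball 0 R" "strict_mono r"
      and lim: "((\<lambda>n. u (n + N)) \<circ> r) \<longlonglongrightarrow> l"
    unfolding compact_def by metis
  have l0: "Im l > 0" using l c by auto
  have "isCont g l"
    using holomorphic_on_imp_continuous_on[OF hol] l0
    by (simp add: continuous_on_eq_continuous_at[OF open_upper_half_plane] upper_half_plane_iff)
  then have "(\<lambda>n. g (u (r n + N))) \<longlonglongrightarrow> g l"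
    using lim isCont_tendsto_compose by (fastforce simp: o_def)
  moreover have "(\<lambda>n. e (r n + N)) \<longlonglongrightarrow> 0"
    using LIMSEQ_subseq_LIMSEQ[OF LIMSEQ_ignore_initial_segment[OF e0, of N] l(2)] by (simp add: o_def)
  ultimately have "(\<lambda>n. \<phi> (e (r n + N)) (g (u (r n + N)))) \<longlonglongrightarrow> g l"
    using \<phi>_lim[of "\<lambda>n. r n + N" "\<lambda>n. g (u (r n + N))" "g l"] by simp
  then have "(\<lambda>n. u (r n + N)) \<longlonglongrightarrow> g l" by (simp add: fix_u)
  with lim have "g l = l" by (auto simp: o_def intro: LIMSEQ_unique)
  then show ?thesis using l0 by blast
qed

section \<open>The class of reciprocal Cauchy transforms\<close>

text \<open>
  With the identity split off, no linear growth is left, so that the estimates for sublinear Pick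
  functions apply.
\<close>

lemma F_class_iff:
  "F \<in> F_class \<longleftrightarrow> pick_function (\<lambda>z. F z - z) \<and> sublinear (\<lambda>z. F z - z)"
proof
  assume F: "F \<in> F_class"
  let ?q = "\<lambda>z. Im (F z) / Im z"
  have hol: "F holomorphic_on upper_half_plane" and pos: "\<And>z. Im z > 0 \<Longrightarrow> Im (F z) > 0"
    and inf: "(INF z\<in>upper_half_plane. ?q z) = 1"
    using F by (auto simp: F_class_def upper_half_plane_iff image_subset_iff)
  have bdd: "bdd_below (?q ` upper_half_plane)"
    by (rule bdd_belowI[of _ 0]) (use pos in \<open>auto simp: upper_half_plane_iff less_imp_le\<close>)
  have "1 \<le> ?q z" if "Im z > 0" for z
    using cINF_lower[OF bdd, of z] that by (simp add: inf upper_half_plane_iff)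
  then have "pick_function (\<lambda>z. F z - z)"
    unfolding pick_function_def using hol
    by (auto intro!: holomorphic_intros simp: upper_half_plane_iff field_simps)
  moreover have "sublinear (\<lambda>z. F z - z)"
    unfolding sublinear_def
  proof (intro allI impI)
    fix \<delta> :: real assume "\<delta> > 0"
    moreover have "\<i> \<in> upper_half_plane" by (simp add: upper_half_plane_iff)
    ultimately obtain p where "p \<in> upper_half_plane" "?q p < 1 + \<delta>"
      using cInf_lessD[of "?q ` upper_half_plane" "1 + \<delta>"] inf by auto
    then show "\<exists>p\<in>upper_half_plane. Im (F p - p) \<le> \<delta> * Im p"
      by (intro bexI[of _ p]) (auto simp: upper_half_plane_iff field_simps)
  qed
  ultimately show "pick_function (\<lambda>z. F z - z) \<and> sublinear (\<lambda>z. F z - z)" ..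
next
  assume "pick_function (\<lambda>z. F z - z) \<and> sublinear (\<lambda>z. F z - z)"
  then have hol: "(\<lambda>z. F z - z) holomorphic_on upper_half_plane"
    and ge: "\<And>z. Im z > 0 \<Longrightarrow> Im (F z) \<ge> Im z"
    and sub: "\<And>\<delta>. \<delta> > 0 \<Longrightarrow> \<exists>p\<in>upper_half_plane. Im (F p) - Im p \<le> \<delta> * Im p"
    by (auto simp: pick_function_def sublinear_def upper_half_plane_iff)
  let ?q = "\<lambda>z. Im (F z) / Im z"
  have "(\<lambda>z. (F z - z) + z) holomorphic_on upper_half_plane"
    by (intro holomorphic_intros hol)
  moreover have "F ` upper_half_plane \<subseteq> upper_half_plane"
    using ge by (force simp: upper_half_plane_iff)
  moreover have "(INF z\<in>upper_half_plane. ?q z) = 1"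
  proof (rule antisym)
    have bdd: "bdd_below (?q ` upper_half_plane)"
      by (rule bdd_belowI[of _ 1]) (use ge in \<open>auto simp: upper_half_plane_iff field_simps\<close>)
    show "(INF z\<in>upper_half_plane. ?q z) \<le> 1"
    proof (rule field_le_epsilon)
      fix \<delta> :: real assume "\<delta> > 0"
      then obtain p where p: "p \<in> upper_half_plane" "Im (F p) - Im p \<le> \<delta> * Im p" using sub by blast
      then have "?q p \<le> 1 + \<delta>" by (simp add: upper_half_plane_iff field_simps)
      then show "(INF z\<in>upper_half_plane. ?q z) \<le> 1 + \<delta>"
        using p(1) by (intro cINF_lower2[OF bdd])
    qed
    show "1 \<le> (INF z\<in>upper_half_plane. ?q z)"
    proof (rule cINF_greatest)
      have "\<i> \<in> upper_half_plane" by (simp add: upper_half_plane_iff)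
      then show "upper_half_plane \<noteq> {}" by blast
    qed (use ge in \<open>auto simp: upper_half_plane_iff field_simps\<close>)
  qed
  ultimately show "F \<in> F_class" by (simp add: F_class_def)
qed

lemma sublinear_if_tendsto:
  assumes "((\<lambda>y. Im (h (\<i> * of_real y)) / y) \<longlongrightarrow> 0) at_top"
  shows "sublinear h"
  unfolding sublinear_def
proof (intro allI impI)
  fix \<delta> :: real assume "\<delta> > 0"
  from order_tendstoD(2)[OF assms this]
  have "eventually (\<lambda>y. Im (h (\<i> * of_real y)) / y < \<delta> \<and> y > 0) at_top"
    using eventually_gt_at_top[of 0] by eventually_elim simp
  then obtain y where "Im (h (\<i> * of_real y)) / y < \<delta>" "y > 0"
    using eventually_happens'[OF trivial_limit_at_top_linorder] by blast
  then show "\<exists>p\<in>upper_half_plane. Im (h p) \<le> \<delta> * Im p"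
    by (intro bexI[of _ "\<i> * of_real y"]) (auto simp: upper_half_plane_iff field_simps)
qed

lemma tendsto_Im_over:
  assumes "((\<lambda>y. f y / of_real y) \<longlongrightarrow> 0) F"
  shows "((\<lambda>y. Im (f y) / y) \<longlongrightarrow> 0) F"
  using tendsto_Im[OF assms] by (simp add: Im_divide_of_real)

lemma F_class_Im_ge:
  assumes "F \<in> F_class" "Im z > 0"
  shows "Im (F z) \<ge> Im z" "Im (F z) > 0"
  using assms by (auto simp: F_class_iff pick_function_def upper_half_plane_iff intro: less_le_trans)

lemma F_class_pick:
  assumes "F \<in> F_class" shows "pick_function F"
  using assms by (auto simp: F_class_def pick_function_def image_subset_iff upper_half_plane_iff less_imp_le)

lemma F_class_tendsto:
  assumes F: "F \<in> F_class"
  shows "((\<lambda>y. F (\<i> * of_real y) / of_real y) \<longlongrightarrow> \<i>) at_top"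
proof -
  have "pick_function (\<lambda>z. z)" by (auto simp: pick_function_def upper_half_plane_iff)
  from pick_comp_sublinear[OF _ _ this, of "\<lambda>z. F z - z" 1] F
  have "((\<lambda>y. (F (\<i> * of_real y) - \<i> * of_real y) / of_real y) \<longlongrightarrow> 0) at_top"
    by (simp add: F_class_iff)
  then have "((\<lambda>y. (F (\<i> * of_real y) - \<i> * of_real y) / of_real y + \<i>) \<longlongrightarrow> 0 + \<i>) at_top"
    by (intro tendsto_intros)
  moreover have "eventually (\<lambda>y. (F (\<i> * of_real y) - \<i> * of_real y) / of_real y + \<i>
      = F (\<i> * of_real y) / of_real y) at_top"
    using eventually_gt_at_top[of 0] by eventually_elim (auto simp: field_simps)
  ultimately show ?thesis using tendsto_cong by fastforce
qed

text \<open>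
  The defect \<open>F (Z z) - z\<close> splits into \<open>F (Z z) - Z z\<close> and \<open>Z z - z\<close>, and both are negligible along
  the imaginary axis.
\<close>

lemma F_class_compose:
  assumes F: "F \<in> F_class" and Z: "Z \<in> F_class"
  shows "(\<lambda>z. F (Z z)) \<in> F_class"
  unfolding F_class_iff
proof
  have hol: "(\<lambda>z. F (Z z)) holomorphic_on upper_half_plane"
    using holomorphic_on_compose_gen[of Z upper_half_plane F upper_half_plane] F Z
    by (simp add: F_class_def o_def)
  have "Im (F (Z z)) \<ge> Im z" if "Im z > 0" for z
    using F_class_Im_ge[OF Z that] F_class_Im_ge[OF F, of "Z z"] by linarith
  then show "pick_function (\<lambda>z. F (Z z) - z)"
    using hol by (auto simp: pick_function_def upper_half_plane_iff intro!: holomorphic_intros)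
  have "Im (Z (\<i> * of_real y)) \<ge> 1" if "y \<ge> 1" for y
    using F_class_Im_ge(1)[OF Z, of "\<i> * of_real y"] that by simp
  then have 1: "((\<lambda>y. Im (F (Z (\<i> * of_real y)) - Z (\<i> * of_real y)) / y) \<longlongrightarrow> 0) at_top"
    using pick_comp_sublinear[of "\<lambda>z. F z - z" Z 1] F F_class_pick[OF Z]
    by (intro tendsto_Im_over) (simp add: F_class_iff)
  have "((\<lambda>y. Im (Z (\<i> * of_real y)) / y) \<longlongrightarrow> 1) at_top"
    using tendsto_Im[OF F_class_tendsto[OF Z]] by (simp add: Im_divide_of_real)
  from tendsto_diff[OF this tendsto_const[of 1]]
  have 2: "((\<lambda>y. Im (Z (\<i> * of_real y)) / y - 1) \<longlongrightarrow> 0) at_top" by simp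
  show "sublinear (\<lambda>z. F (Z z) - z)"
  proof (rule sublinear_if_tendsto, rule Lim_transform_eventually)
    show "((\<lambda>y. Im (F (Z (\<i> * of_real y)) - Z (\<i> * of_real y)) / y
        + (Im (Z (\<i> * of_real y)) / y - 1)) \<longlongrightarrow> 0) at_top"
      using tendsto_add[OF 1 2] by simp
    show "eventually (\<lambda>y. Im (F (Z (\<i> * of_real y)) - Z (\<i> * of_real y)) / y
        + (Im (Z (\<i> * of_real y)) / y - 1) = Im (F (Z (\<i> * of_real y)) - \<i> * of_real y) / y) at_top"
      using eventually_gt_at_top[of 0] by eventually_elim (auto simp: field_simps)
  qed
qed

lemma F_class_boolean:
  assumes F: "F \<in> F_class" and G: "G \<in> F_class"
  shows "(\<lambda>z. F z + G z - z) \<in> F_class"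
  unfolding F_class_iff
proof
  have hol: "F holomorphic_on upper_half_plane" "G holomorphic_on upper_half_plane"
    using F G by (auto simp: F_class_def)
  show "pick_function (\<lambda>z. F z + G z - z - z)"
    using hol F_class_Im_ge(1)[OF F] F_class_Im_ge(1)[OF G]
    by (auto simp: pick_function_def upper_half_plane_iff intro!: holomorphic_intros)
       (smt (verit))
  show "sublinear (\<lambda>z. F z + G z - z - z)"
  proof (rule sublinear_if_tendsto, rule Lim_transform_eventually)
    show "((\<lambda>y. Im (F (\<i> * of_real y) / of_real y) + Im (G (\<i> * of_real y) / of_real y) - 1 - 1)
        \<longlongrightarrow> 0) at_top"
      by (rule tendsto_eq_rhs[OF tendsto_diff[OF tendsto_diff[OF tendsto_add[OF
          tendsto_Im[OF F_class_tendsto[OF F]] tendsto_Im[OF F_class_tendsto[OF G]]] tendsto_const]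
          tendsto_const]]) simp
    show "eventually (\<lambda>y. Im (F (\<i> * of_real y) / of_real y) + Im (G (\<i> * of_real y) / of_real y) - 1 - 1
       = Im (F (\<i> * of_real y) + G (\<i> * of_real y) - \<i> * of_real y - \<i> * of_real y) / y) at_top"
      using eventually_gt_at_top[of 0] by eventually_elim (auto simp: Im_divide_of_real field_simps)
  qed
qed

section \<open>Subordination functions\<close>

text \<open>
  The two equations form the subordination system at a point \<open>z\<close> in terms of \<open>h\<^sub>i = F\<^sub>i - id\<close>.  They
  are solved for \<open>h2 Q\<close> and \<open>h1 P\<close>, since \<open>P = z + h2 Q\<close> and \<open>Q = z + h1 P\<close> form a cycle when used
  as rewrite rules.
\<close>

definition subordinate ::
  "(complex \<Rightarrow> complex) \<Rightarrow> (complex \<Rightarrow> complex) \<Rightarrow> complex \<Rightarrow> complex \<Rightarrow> complex \<Rightarrow> bool" where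
  "subordinate h1 h2 z P Q \<longleftrightarrow> Im P > 0 \<and> Im Q > 0 \<and> h2 Q = P - z \<and> h1 P = Q - z"

text \<open>
  The Lipschitz factor that Schwarz-Pick provides for the pair \<open>w1\<close>, \<open>w2\<close>.
\<close>

definition dilation :: "(complex \<Rightarrow> complex) \<Rightarrow> complex \<Rightarrow> complex \<Rightarrow> real" where
  "dilation h w1 w2 = sqrt (Im (h w1) * Im (h w2) / (Im w1 * Im w2))"

lemma pick_lipschitz:
  assumes "pick_function h" "Im w1 > 0" "Im w2 > 0"
  shows "cmod (h w1 - h w2) \<le> dilation h w1 w2 * cmod (w1 - w2)"
proof -
  have "(cmod (h w1 - h w2))\<^sup>2 \<le> (Im (h w1) * Im (h w2) / (Im w1 * Im w2)) * (cmod (w1 - w2))\<^sup>2"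
    using schwarz_pick[OF assms] assms(2,3) by (simp add: field_simps)
  from real_sqrt_le_mono[OF this] show ?thesis
    unfolding dilation_def by (simp only: real_sqrt_mult real_sqrt_abs abs_norm_cancel)
qed

lemma dilation_nonneg:
  assumes "pick_function h" "Im w1 > 0" "Im w2 > 0"
  shows "dilation h w1 w2 \<ge> 0"
  using assms by (auto simp: dilation_def pick_function_def upper_half_plane_iff)

lemma subordinate_Im:
  assumes "pick_function h1" "pick_function h2" "subordinate h1 h2 z P Q"
  shows "Im (h1 P) = Im Q - Im z" "Im (h2 Q) = Im P - Im z" "Im z \<le> Im P" "Im z \<le> Im Q"
        "Im P > 0" "Im Q > 0"
proof -
  have pos: "Im P > 0" "Im Q > 0" and eq: "h2 Q = P - z" "h1 P = Q - z"
    using assms(3) by (auto simp: subordinate_def)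
  show "Im P > 0" "Im Q > 0" by fact+
  show 1: "Im (h1 P) = Im Q - Im z" "Im (h2 Q) = Im P - Im z"
    by (simp_all add: eq)
  have "Im (h1 P) \<ge> 0" "Im (h2 Q) \<ge> 0"
    using assms(1,2) pos by (auto simp: pick_function_def upper_half_plane_iff)
  with 1 show "Im z \<le> Im P" "Im z \<le> Im Q" by auto
qed

text \<open>
  The product of the two factors is \<open>sqrt\<close> of the product of \<open>(Im P - Im z) / Im P\<close> and the three
  analogous quotients for \<open>P'\<close>, \<open>Q\<close>, \<open>Q'\<close>, all at most 1.  Keeping only the first one gives a bound
  that is uniform in the primed solution.
\<close>

lemma subordinate_contraction:
  assumes h: "pick_function h1" "pick_function h2"
    and s: "subordinate h1 h2 z P Q" "subordinate h1 h2 z' P' Q'"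
    and z: "Im z > 0" "Im z' > 0"
  shows "dilation h2 Q Q' * dilation h1 P P' \<le> sqrt ((Im P - Im z) / Im P)"
proof -
  note I = subordinate_Im[OF h s(1)] and I' = subordinate_Im[OF h s(2)]
  define r where "r = (\<lambda>a y. (a - y) / a :: real)"
  have r: "0 \<le> r a y \<and> r a y \<le> 1" if "0 < a" "0 < y" "y \<le> a" for a y
    using that by (auto simp: r_def)
  have "dilation h2 Q Q' * dilation h1 P P'
      = sqrt (r (Im P) (Im z) * (r (Im P') (Im z') * (r (Im Q) (Im z) * r (Im Q') (Im z'))))"
    unfolding dilation_def real_sqrt_mult[symmetric] I I' r_def
    by (intro arg_cong[of _ _ sqrt]) (simp add: mult_ac)
  also have "\<dots> \<le> sqrt (r (Im P) (Im z) * 1)"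
    using r[of "Im P" "Im z"] r[of "Im P'" "Im z'"] r[of "Im Q" "Im z"] r[of "Im Q'" "Im z'"] z I I'
    by (intro real_sqrt_le_mono mult_left_mono mult_le_one mult_nonneg_nonneg) auto
  finally show ?thesis by (simp add: r_def)
qed

text \<open>
  Chaining the Lipschitz estimates of both equations; the contraction lets the displacement of \<open>P\<close>
  on the right-hand side be absorbed.
\<close>

lemma subordinate_displacement:
  assumes h: "pick_function h1" "pick_function h2"
    and s: "subordinate h1 h2 z P Q" "subordinate h1 h2 z' P' Q'"
    and z: "Im z > 0" "Im z' > 0"
  shows "(1 - sqrt ((Im P - Im z) / Im P)) * cmod (P - P') \<le> (1 + dilation h2 Q Q') * cmod (z - z')"
proof -
  note I = subordinate_Im[OF h s(1)] and I' = subordinate_Im[OF h s(2)]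
  let ?q1 = "dilation h1 P P'" and ?q2 = "dilation h2 Q Q'"
  have q: "?q1 \<ge> 0" "?q2 \<ge> 0"
    using dilation_nonneg[OF h(1) I(5) I'(5)] dilation_nonneg[OF h(2) I(6) I'(6)] by auto
  have eq: "P - P' = (z - z') + (h2 Q - h2 Q')" "Q - Q' = (z - z') + (h1 P - h1 P')"
    using s by (simp_all add: subordinate_def)
  have Q: "cmod (Q - Q') \<le> cmod (z - z') + ?q1 * cmod (P - P')"
    unfolding eq(2)
    using norm_triangle_ineq[of "z - z'" "h1 P - h1 P'"] pick_lipschitz[OF h(1) I(5) I'(5)] by linarith
  have "cmod (P - P') \<le> cmod (z - z') + ?q2 * cmod (Q - Q')"
    unfolding eq(1)
    using norm_triangle_ineq[of "z - z'" "h2 Q - h2 Q'"] pick_lipschitz[OF h(2) I(6) I'(6)] by linarith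
  also have "\<dots> \<le> cmod (z - z') + ?q2 * (cmod (z - z') + ?q1 * cmod (P - P'))"
    using Q q by (intro add_left_mono mult_left_mono)
  also have "\<dots> = (1 + ?q2) * cmod (z - z') + (?q2 * ?q1) * cmod (P - P')"
    by (simp add: algebra_simps)
  also have "\<dots> \<le> (1 + ?q2) * cmod (z - z') + sqrt ((Im P - Im z) / Im P) * cmod (P - P')"
    using subordinate_contraction[OF h s z] by (intro add_left_mono mult_right_mono) auto
  finally show ?thesis by (simp add: algebra_simps)
qed

lemma contraction_factor_less_1:
  "0 < a \<Longrightarrow> 0 < y \<Longrightarrow> sqrt ((a - y) / a) < (1::real)"
  using real_sqrt_less_mono[of "(a - y) / a" 1] by (simp add: field_simps)

lemma subordinate_unique:
  assumes h: "pick_function h1" "pick_function h2"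
    and s: "subordinate h1 h2 z P Q" "subordinate h1 h2 z P' Q'" and z: "Im z > 0"
  shows "P = P' \<and> Q = Q'"
proof -
  have "(1 - sqrt ((Im P - Im z) / Im P)) * cmod (P - P') \<le> 0"
    using subordinate_displacement[OF h s z z] by simp
  moreover have "1 - sqrt ((Im P - Im z) / Im P) > 0"
    using contraction_factor_less_1 subordinate_Im(5)[OF h s(1)] z by simp
  ultimately have PP': "P = P'" by (auto simp: mult_le_0_iff)
  moreover have "Q - z = Q' - z"
    using s PP' unfolding subordinate_def by metis
  ultimately show ?thesis by simp
qed

text \<open>
  The factor \<open>dilation h2 Q Q'\<close> in the displacement estimate still involves \<open>Im P'\<close>, which is at
  most \<open>Im P\<close> plus the displacement \<open>D\<close> itself.  For \<open>z'\<close> close to \<open>z\<close> this contribution is at most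
  half of the left-hand side and is absorbed again.
\<close>

lemma subordinate_locally_lipschitz:
  assumes h: "pick_function h1" "pick_function h2"
    and s: "subordinate h1 h2 z P Q" and z: "Im z > 0"
  shows "\<exists>C d. d > 0 \<and> (\<forall>z' P' Q'. cmod (z - z') < d \<longrightarrow> Im z' > 0 \<longrightarrow> subordinate h1 h2 z' P' Q'
            \<longrightarrow> cmod (P - P') \<le> C * cmod (z - z'))"
proof -
  define a where "a = Im P"
  define y where "y = Im z"
  define \<kappa> where "\<kappa> = sqrt ((a - y) / a)"
  define M where "M = 2 * a / y\<^sup>2"
  define C where "C = 2 * (2 + M * a) / (1 - \<kappa>)"
  define d where "d = min (y / 2) ((1 - \<kappa>) / (2 * M))"
  note I = subordinate_Im[OF h s]
  have a: "a > 0" and y: "y > 0" using I z by (auto simp: a_def y_def)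
  have \<kappa>: "1 - \<kappa> > 0" using contraction_factor_less_1[OF a y] by (simp add: \<kappa>_def)
  have M: "M > 0" using a y by (simp add: M_def)
  have "d > 0" using y \<kappa> M by (simp add: d_def)
  moreover have "cmod (P - P') \<le> C * cmod (z - z')"
    if zd: "cmod (z - z') < d" and z': "Im z' > 0" and s': "subordinate h1 h2 z' P' Q'" for z' P' Q'
  proof -
    note I' = subordinate_Im[OF h s']
    define D where "D = cmod (P - P')"
    define \<Delta> where "\<Delta> = cmod (z - z')"
    let ?q = "dilation h2 Q Q'"
    have "Im (z - z') \<le> y / 2"
      using zd abs_Im_le_cmod[of "z - z'"] abs_ge_self[of "Im (z - z')"] by (simp add: d_def)
    then have y': "Im z' \<ge> y / 2" by (simp add: y_def field_simps)
    have "\<bar>Im (P - P')\<bar> \<le> D" unfolding D_def by (rule abs_Im_le_cmod)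
    then have a': "Im P' \<le> a + D" by (simp add: a_def)
    have "?q\<^sup>2 = (a - y) * (Im P' - Im z') / (Im Q * Im Q')"
      unfolding dilation_def I(2) I'(2) a_def y_def
      using I(3-6) I'(3-6)
      by (intro real_sqrt_pow2 divide_nonneg_nonneg mult_nonneg_nonneg) linarith+
    also have "\<dots> \<le> a * (a + D) / (y * (y / 2))"
    proof (rule frac_le)
      show "(a - y) * (Im P' - Im z') \<le> a * (a + D)"
        using y a a' z' I'(3) by (intro mult_mono) linarith+
      show "y * (y / 2) \<le> Im Q * Im Q'"
        using y y' I(4) I'(4) by (intro mult_mono) (simp_all add: y_def)
      show "0 \<le> a * (a + D)" using a by (simp add: D_def)
      show "0 < y * (y / 2)" using y by simp
    qed
    also have "\<dots> = M * (a + D)" by (simp add: M_def power2_eq_square)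
    finally have q2: "?q\<^sup>2 \<le> M * (a + D)" .
    have "2 * ?q \<le> ?q\<^sup>2 + 1" using sum_squares_bound[of ?q 1] by simp
    then have "?q \<le> 1 + ?q\<^sup>2" using zero_le_power2[of ?q] by linarith
    with q2 have "1 + ?q \<le> 2 + M * (a + D)" by simp
    then have "(1 + ?q) * \<Delta> \<le> (2 + M * (a + D)) * \<Delta>" by (intro mult_right_mono) (auto simp: \<Delta>_def)
    with subordinate_displacement[OF h s s' z z']
    have "(1 - \<kappa>) * D \<le> (2 + M * (a + D)) * \<Delta>"
      unfolding \<kappa>_def a_def y_def D_def \<Delta>_def by linarith
    also have "\<dots> = (2 + M * a) * \<Delta> + (M * \<Delta>) * D" by (simp add: algebra_simps)
    also have "\<dots> \<le> (2 + M * a) * \<Delta> + ((1 - \<kappa>) / 2) * D"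
    proof -
      have "\<Delta> \<le> (1 - \<kappa>) / (2 * M)" using zd by (simp add: d_def \<Delta>_def)
      then have "M * \<Delta> \<le> (1 - \<kappa>) / 2" using M by (simp add: field_simps)
      then show ?thesis by (intro add_left_mono mult_right_mono) (auto simp: D_def)
    qed
    finally have "D * (1 - \<kappa>) \<le> 2 * (2 + M * a) * \<Delta>" by argo
    then have "D \<le> 2 * (2 + M * a) * \<Delta> / (1 - \<kappa>)" using \<kappa> by (simp only: pos_le_divide_eq)
    then show ?thesis by (simp add: C_def D_def \<Delta>_def)
  qed
  ultimately show ?thesis by blast
qed

lemma pick_isCont:
  assumes "pick_function h" "Im w > 0"
  shows "isCont h w" "h field_differentiable at w"
proof -
  show "h field_differentiable at w"
    using assms holomorphic_on_imp_differentiable_at[OF _ open_upper_half_plane]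
    by (simp add: pick_function_def upper_half_plane_iff)
  then show "isCont h w" by (rule field_differentiable_imp_continuous_at)
qed

lemma eventually_Im_pos_at: "Im w > 0 \<Longrightarrow> eventually (\<lambda>v. Im v > 0) (at w)"
  using eventually_at_in_open'[OF open_upper_half_plane] by (simp add: upper_half_plane_iff)

text \<open>
  The infinitesimal form of Schwarz-Pick.
\<close>

lemma pick_derivative_bound:
  assumes h: "pick_function h" and w: "Im w > 0" and d: "(h has_field_derivative d) (at w)"
  shows "cmod d \<le> Im (h w) / Im w"
proof (rule tendsto_le[OF trivial_limit_at])
  have hw: "Im (h w) \<ge> 0" using h w by (auto simp: pick_function_def upper_half_plane_iff)
  show "((\<lambda>v. cmod ((h v - h w) / (v - w))) \<longlongrightarrow> cmod d) (at w)"
    using d by (intro tendsto_norm) (simp add: has_field_derivative_iff)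
  have "(h \<longlongrightarrow> h w) (at w)" using pick_isCont[OF h w] by (simp add: isCont_def)
  then have "((\<lambda>v. dilation h v w) \<longlongrightarrow> dilation h w w) (at w)"
    unfolding dilation_def using w by (auto intro!: tendsto_intros)
  moreover have "dilation h w w = Im (h w) / Im w"
    using hw w by (simp add: dilation_def real_sqrt_divide)
  ultimately show "((\<lambda>v. dilation h v w) \<longlongrightarrow> Im (h w) / Im w) (at w)" by simp
  show "eventually (\<lambda>v. cmod ((h v - h w) / (v - w)) \<le> dilation h v w) (at w)"
    using eventually_Im_pos_at[OF w] eventually_neq_at_within[of w w UNIV]
  proof eventually_elim
    case (elim v)
    then show ?case using pick_lipschitz[OF h elim(1) w] by (simp add: norm_divide divide_le_eq)
  qed
qed

text \<open>
  With Caratheodory's difference quotients \<open>H1\<close>, \<open>H2\<close> of \<open>h1\<close>, \<open>h2\<close> the increments satisfy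
  \<open>\<Delta>P (1 - H2 H1) = (1 + H2) \<Delta>z\<close>.  In the limit \<open>1 - H2 H1\<close> does not vanish, because the infinitesimal
  contraction factor is below 1; this replaces an implicit function theorem.
\<close>

lemma subordinate_field_differentiable:
  assumes h: "pick_function h1" "pick_function h2"
    and s: "\<And>z. Im z > 0 \<Longrightarrow> subordinate h1 h2 z (Z1 z) (Z2 z)" and z: "Im z > 0"
  shows "Z1 field_differentiable at z"
proof -
  define P where "P = Z1 z"
  define Q where "Q = Z2 z"
  note s0 = s[OF z, folded P_def Q_def]
  note I = subordinate_Im[OF h s0]
  obtain C d where d: "d > 0" and C0: "\<forall>z' P' Q'. cmod (z - z') < d \<longrightarrow> Im z' > 0 \<longrightarrow>
      subordinate h1 h2 z' P' Q' \<longrightarrow> cmod (P - P') \<le> C * cmod (z - z')"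
    using subordinate_locally_lipschitz[OF h s0 z] by (elim exE conjE)
  have C: "cmod (P - Z1 z') \<le> C * cmod (z - z')" if "cmod (z - z') < d" "Im z' > 0" for z'
    using C0[rule_format, OF that s[OF that(2)]] .
  have cont1: "(Z1 \<longlongrightarrow> P) (at z)"
  proof (rule metric_tendsto_imp_tendsto)
    show "((\<lambda>z'. of_real C * (z - z')) \<longlongrightarrow> 0) (at z)" by (auto intro!: tendsto_eq_intros)
    show "eventually (\<lambda>z'. dist (Z1 z') P \<le> dist (of_real C * (z - z')) 0) (at z)"
      using eventually_Im_pos_at[OF z] eventually_at_ball[OF d, of z UNIV]
    proof eventually_elim
      case (elim z')
      then have "cmod (P - Z1 z') \<le> C * cmod (z - z')" by (intro C) (auto simp: dist_norm)
      also have "\<dots> \<le> \<bar>C\<bar> * cmod (z - z')" by (intro mult_right_mono) auto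
      finally show ?case by (simp add: dist_norm norm_mult norm_minus_commute)
    qed
  qed
  obtain d1 d2 where d1: "(h1 has_field_derivative d1) (at P)" and d2: "(h2 has_field_derivative d2) (at Q)"
    using pick_isCont(2)[OF h(1) I(5)] pick_isCont(2)[OF h(2) I(6)]
    unfolding field_differentiable_def by blast
  obtain H1 where H1: "\<And>w. h1 w - h1 P = H1 w * (w - P)" "isCont H1 P" "H1 P = d1"
    using d1 unfolding CARAT_DERIV by blast
  obtain H2 where H2: "\<And>w. h2 w - h2 Q = H2 w * (w - Q)" "isCont H2 Q" "H2 Q = d2"
    using d2 unfolding CARAT_DERIV by blast
  have ev: "eventually (\<lambda>z'. Im z' > 0) (at z)" by (rule eventually_Im_pos_at[OF z])
  have cont2: "(Z2 \<longlongrightarrow> Q) (at z)"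
  proof (rule Lim_transform_eventually)
    show "((\<lambda>z'. z' + h1 (Z1 z')) \<longlongrightarrow> Q) (at z)"
      using isCont_tendsto_compose[OF pick_isCont(1)[OF h(1) I(5)] cont1] s0
      by (auto intro!: tendsto_eq_intros simp: subordinate_def)
    show "eventually (\<lambda>z'. z' + h1 (Z1 z') = Z2 z') (at z)"
      using ev by eventually_elim (use s in \<open>simp add: subordinate_def\<close>)
  qed
  have L1: "((\<lambda>z'. H1 (Z1 z')) \<longlongrightarrow> d1) (at z)" "((\<lambda>z'. H2 (Z2 z')) \<longlongrightarrow> d2) (at z)"
    using isCont_tendsto_compose[OF H1(2) cont1] isCont_tendsto_compose[OF H2(2) cont2]
    unfolding H1(3) H2(3) by auto
  have "cmod (d2 * d1) < 1"
  proof -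
    have "cmod (d2 * d1) \<le> ((Im P - Im z) / Im Q) * ((Im Q - Im z) / Im P)"
      using pick_derivative_bound[OF h(1) I(5) d1] pick_derivative_bound[OF h(2) I(6) d2] I(3-6)
      unfolding norm_mult I(1,2) by (intro mult_mono) auto
    also have "\<dots> = ((Im P - Im z) / Im P) * ((Im Q - Im z) / Im Q)" by simp
    also have "\<dots> \<le> ((Im P - Im z) / Im P) * 1" using I z by (intro mult_left_mono) auto
    also have "\<dots> < 1" using I z by simp
    finally show ?thesis .
  qed
  then have nz: "1 - d2 * d1 \<noteq> 0" by auto
  have L2: "((\<lambda>z'. 1 - H2 (Z2 z') * H1 (Z1 z')) \<longlongrightarrow> 1 - d2 * d1) (at z)"
    by (intro tendsto_intros L1)
  have "((\<lambda>z'. (Z1 z' - Z1 z) / (z' - z)) \<longlongrightarrow> (1 + d2) / (1 - d2 * d1)) (at z)"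
  proof (rule Lim_transform_eventually)
    show "((\<lambda>z'. (1 + H2 (Z2 z')) / (1 - H2 (Z2 z') * H1 (Z1 z'))) \<longlongrightarrow> (1 + d2) / (1 - d2 * d1)) (at z)"
      by (intro tendsto_intros L1 nz)
    show "eventually (\<lambda>z'. (1 + H2 (Z2 z')) / (1 - H2 (Z2 z') * H1 (Z1 z')) = (Z1 z' - Z1 z) / (z' - z)) (at z)"
      using ev eventually_neq_at_within[of z z UNIV] tendsto_imp_eventually_ne[OF L2 nz]
    proof eventually_elim
      case (elim z')
      have "Z1 z' - P = (z' - z) + (h2 (Z2 z') - h2 Q)" "Z2 z' - Q = (z' - z) + (h1 (Z1 z') - h1 P)"
        using s[OF elim(1)] s0 by (simp_all add: subordinate_def)
      then have e: "Z1 z' - P = (z' - z) + H2 (Z2 z') * (Z2 z' - Q)" "Z2 z' - Q = (z' - z) + H1 (Z1 z') * (Z1 z' - P)"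
        by (simp_all only: H1(1) H2(1))
      have "(Z1 z' - P) * (1 - H2 (Z2 z') * H1 (Z1 z')) = (1 + H2 (Z2 z')) * (z' - z)"
      proof -
        let ?X = "Z1 z' - P" and ?Y = "Z2 z' - Q" and ?a = "H1 (Z1 z')" and ?b = "H2 (Z2 z')"
        have "?X * (1 - ?b * ?a) = ?X - ?b * (?a * ?X)" by (simp add: algebra_simps)
        also have "?a * ?X = ?Y - (z' - z)" unfolding e(2) by simp
        also have "?X - ?b * (?Y - (z' - z)) = (?X - ?b * ?Y) + ?b * (z' - z)" by (simp add: algebra_simps)
        also have "?X - ?b * ?Y = z' - z" unfolding e(1) by simp
        finally show ?thesis by (simp add: algebra_simps)
      qed
      then show ?case using elim by (simp add: P_def field_simps)
    qed
  qed
  then show ?thesis unfolding field_differentiable_def has_field_derivative_iff by blast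
qed

text \<open>
  By \<open>pick_comp_sublinear\<close> with \<open>v w = z + h1 w\<close>, the map \<open>w \<mapsto> z + h2 (v w)\<close> lowers the imaginary part of
  \<open>iy\<close> for large \<open>y\<close>, so it has a fixed point \<open>P\<close>.
\<close>

lemma subordinate_exists:
  assumes h: "pick_function h1" "pick_function h2" "sublinear h2" and z: "Im z > 0"
  shows "\<exists>P Q. subordinate h1 h2 z P Q"
proof -
  define v where "v = (\<lambda>w. z + h1 w)"
  define g where "g = (\<lambda>w. z + h2 (v w))"
  have v_Im: "Im (v w) \<ge> Im z" if "Im w > 0" for w
    using h that by (auto simp: v_def pick_function_def upper_half_plane_iff)
  have v_hol: "v holomorphic_on upper_half_plane"
    using h unfolding v_def pick_function_def by (auto intro!: holomorphic_intros)
  have v_maps: "v ` upper_half_plane \<subseteq> upper_half_plane"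
    using v_Im z by (force simp: upper_half_plane_iff)
  have v: "pick_function v"
    using v_hol v_maps by (auto simp: pick_function_def upper_half_plane_iff image_subset_iff less_imp_le)
  have "(\<lambda>w. h2 (v w)) holomorphic_on upper_half_plane"
    using holomorphic_on_compose_gen[OF v_hol _ v_maps, of h2] h by (simp add: o_def pick_function_def)
  then have g_hol: "g holomorphic_on upper_half_plane"
    unfolding g_def by (intro holomorphic_intros)
  have g_Im: "Im (g w) \<ge> Im z" if "Im w > 0" for w
  proof -
    have "Im (v w) > 0" using v_Im[OF that] z by linarith
    then have "Im (h2 (v w)) \<ge> 0" using h by (auto simp: pick_function_def upper_half_plane_iff)
    then show ?thesis by (simp add: g_def)
  qed
  have "((\<lambda>y. Im (h2 (v (\<i> * of_real y))) / y) \<longlongrightarrow> 0) at_top"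
    using v_Im z by (intro tendsto_Im_over pick_comp_sublinear[OF h(2,3) v, of "Im z"]) auto
  moreover have "((\<lambda>y. Im z / y) \<longlongrightarrow> 0) at_top"
    by (rule tendsto_divide_0[OF tendsto_const filterlim_at_top_imp_at_infinity[OF filterlim_ident]])
  ultimately have "((\<lambda>y. Im z / y + Im (h2 (v (\<i> * of_real y))) / y) \<longlongrightarrow> 0 + 0) at_top"
    by (intro tendsto_add)
  then have "eventually (\<lambda>y. Im z / y + Im (h2 (v (\<i> * of_real y))) / y < 1) at_top"
    by (rule order_tendstoD(2)) simp
  then have "eventually (\<lambda>y. Im z / y + Im (h2 (v (\<i> * of_real y))) / y < 1 \<and> y > 0) at_top"
    using eventually_gt_at_top[of 0] by eventually_elim simp
  then obtain y where "Im z / y + Im (h2 (v (\<i> * of_real y))) / y < 1" and y: "y > 0"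
    using eventually_happens'[OF trivial_limit_at_top_linorder] by blast
  then have "Im (g (\<i> * of_real y)) < Im (\<i> * of_real y)"
    by (simp add: g_def field_simps)
  then obtain P where P: "Im P > 0" "g P = P"
    using fixed_point_of_half_plane_map[OF g_hol z g_Im, of "\<i> * of_real y"] y by auto
  have "subordinate h1 h2 z P (v P)"
    using P v_Im[OF P(1)] z by (auto simp: subordinate_def g_def v_def algebra_simps)
  then show ?thesis by blast
qed

lemma subordinate_swap: "subordinate h1 h2 z P Q \<longleftrightarrow> subordinate h2 h1 z Q P"
  by (auto simp: subordinate_def)

text \<open>
  Since \<open>Z1 z - z = h2 (Z2 z)\<close> and \<open>Z2\<close> is itself a Pick function with \<open>Im (Z2 z) \<ge> Im z\<close>, sublinearity
  of \<open>h2\<close> carries over.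
\<close>

lemma subordinate_in_F_class:
  assumes h: "pick_function h1" "pick_function h2" "sublinear h2"
    and s: "\<And>z. Im z > 0 \<Longrightarrow> subordinate h1 h2 z (Z1 z) (Z2 z)"
  shows "Z1 \<in> F_class"
  unfolding F_class_iff
proof
  have "Z1 field_differentiable at z" if "Im z > 0" for z
    using subordinate_field_differentiable[of h1 h2 Z1 Z2] h s that by blast
  then have hol1: "Z1 holomorphic_on upper_half_plane"
    by (auto simp: holomorphic_on_def upper_half_plane_iff intro: field_differentiable_at_within)
  have "Z2 field_differentiable at z" if "Im z > 0" for z
    using subordinate_field_differentiable[of h2 h1 Z2 Z1] h s that subordinate_swap by blast
  then have hol2: "Z2 holomorphic_on upper_half_plane"
    by (auto simp: holomorphic_on_def upper_half_plane_iff intro: field_differentiable_at_within)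
  note I = subordinate_Im[OF h(1,2) s]
  have Z2: "pick_function Z2" using hol2 I by (force simp: pick_function_def upper_half_plane_iff)
  show "pick_function (\<lambda>z. Z1 z - z)"
    using hol1 I by (auto simp: pick_function_def upper_half_plane_iff intro!: holomorphic_intros)
  have "((\<lambda>y. Im (h2 (Z2 (\<i> * of_real y))) / y) \<longlongrightarrow> 0) at_top"
  proof (intro tendsto_Im_over pick_comp_sublinear[OF h(2,3) Z2, of 1])
    show "1 \<le> Im (Z2 (\<i> * of_real y))" if "1 \<le> y" for y
      using I(4)[of "\<i> * of_real y"] that by simp
  qed simp
  then show "sublinear (\<lambda>z. Z1 z - z)"
  proof (rule sublinear_if_tendsto[OF Lim_transform_eventually])
    show "eventually (\<lambda>y. Im (h2 (Z2 (\<i> * of_real y))) / y = Im (Z1 (\<i> * of_real y) - \<i> * of_real y) / y) at_top"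
      using eventually_gt_at_top[of 0] by eventually_elim (use I(2) in simp)
  qed
qed

definition subordinating :: "(complex \<Rightarrow> complex) \<Rightarrow> (complex \<Rightarrow> complex) \<Rightarrow>
    (complex \<Rightarrow> complex) \<Rightarrow> (complex \<Rightarrow> complex) \<Rightarrow> bool" where
  "subordinating F1 F2 Z1 Z2 \<longleftrightarrow> (\<forall>z\<in>upper_half_plane.
     F1 (Z1 z) = F2 (Z2 z) \<and> F2 (Z2 z) = Z1 z + Z2 z - z)"

lemma subordinating_iff:
  assumes "\<And>z. Im z > 0 \<Longrightarrow> Im (Z1 z) > 0" "\<And>z. Im z > 0 \<Longrightarrow> Im (Z2 z) > 0"
  shows "subordinating F1 F2 Z1 Z2 \<longleftrightarrow>
    (\<forall>z. Im z > 0 \<longrightarrow> subordinate (\<lambda>w. F1 w - w) (\<lambda>w. F2 w - w) z (Z1 z) (Z2 z))"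
proof -
  have "b - q = p - z \<longleftrightarrow> b = p + q - z" "a - p = q - z \<longleftrightarrow> a = p + q - z" for a b p q z :: complex
    by (auto simp: algebra_simps)
  then show ?thesis
    using assms unfolding subordinating_def subordinate_def Ball_def upper_half_plane_iff by auto
qed

theorem subordinating_exists:
  assumes F: "F1 \<in> F_class" "F2 \<in> F_class"
  shows "\<exists>Z1\<in>F_class. \<exists>Z2\<in>F_class. subordinating F1 F2 Z1 Z2"
proof -
  let ?h1 = "\<lambda>w. F1 w - w" and ?h2 = "\<lambda>w. F2 w - w"
  have h: "pick_function ?h1" "pick_function ?h2" "sublinear ?h1" "sublinear ?h2"
    using F by (auto simp: F_class_iff)
  obtain Z1 Z2 where s: "\<And>z. Im z > 0 \<Longrightarrow> subordinate ?h1 ?h2 z (Z1 z) (Z2 z)"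
    using subordinate_exists[OF h(1,2,4)] by metis
  have "Z1 \<in> F_class" by (rule subordinate_in_F_class[OF h(1,2,4) s])
  moreover have "Z2 \<in> F_class"
    by (rule subordinate_in_F_class[OF h(2,1,3)]) (use s subordinate_swap in blast)
  moreover have "subordinating F1 F2 Z1 Z2"
    using s by (subst subordinating_iff) (auto simp: subordinate_def)
  ultimately show ?thesis by blast
qed

theorem subordinating_unique:
  assumes F: "F1 \<in> F_class" "F2 \<in> F_class"
    and Z: "Z1 \<in> F_class" "Z2 \<in> F_class" "subordinating F1 F2 Z1 Z2"
    and W: "W1 \<in> F_class" "W2 \<in> F_class" "subordinating F1 F2 W1 W2"
    and z: "z \<in> upper_half_plane"
  shows "Z1 z = W1 z \<and> Z2 z = W2 z"
proof (rule subordinate_unique)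
  show "pick_function (\<lambda>w. F1 w - w)" "pick_function (\<lambda>w. F2 w - w)"
    using F by (auto simp: F_class_iff)
  show "subordinate (\<lambda>w. F1 w - w) (\<lambda>w. F2 w - w) z (Z1 z) (Z2 z)"
    using Z z F_class_Im_ge(2) by (auto simp: subordinating_iff upper_half_plane_iff)
  show "subordinate (\<lambda>w. F1 w - w) (\<lambda>w. F2 w - w) z (W1 z) (W2 z)"
    using W z F_class_Im_ge(2) by (auto simp: subordinating_iff upper_half_plane_iff)
  show "Im z > 0" using z by (simp add: upper_half_plane_iff)
qed

section \<open>Cauchy transforms of probability measures\<close>

lemma norm_resolvent_le: "Im z > 0 \<Longrightarrow> cmod (1 / (z - of_real x)) \<le> 1 / Im z"
  using abs_Im_le_cmod[of "z - of_real x"] by (simp add: norm_divide frac_le)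

lemma resolvent_ne_0: "Im z > 0 \<Longrightarrow> z - of_real x \<noteq> 0"
  by (auto simp: complex_eq_iff)

lemma Im_resolvent: "Im (1 / (z - of_real x)) = - (Im z / (cmod (z - of_real x))\<^sup>2)"
  by (simp add: Im_divide')

lemma resolvent_difference:
  fixes a b :: complex
  assumes "a \<noteq> 0" "b \<noteq> 0" "a \<noteq> b"
  shows "(1 / a - 1 / b) / (a - b) + 1 / b\<^sup>2 = (a - b) * (1 / a * (1 / b)\<^sup>2)"
proof -
  have "1 / a - 1 / b = - ((a - b) * (1 / a * (1 / b)))" using assms by (simp add: field_simps)
  then have 1: "(1 / a - 1 / b) / (a - b) = - (1 / a * (1 / b))" using assms by simp
  have 2: "(a - b) * (1 / a) = 1 - b * (1 / a)" using assms by (simp add: field_simps)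
  have "(a - b) * (1 / a * (1 / b)\<^sup>2) = (1 - b * (1 / a)) * (1 / b)\<^sup>2"
    unfolding 2[symmetric] by simp
  also have "\<dots> = 1 / b\<^sup>2 - 1 / a * (1 / b)"
    using assms by (simp add: power2_eq_square diff_divide_distrib)
  finally show ?thesis unfolding 1 by simp
qed

context real_distribution
begin

lemma integrable_resolvent: "Im z > 0 \<Longrightarrow> integrable M (\<lambda>x. 1 / (z - complex_of_real x))"
  by (rule integrable_const_bound[where B="1 / Im z"]) (use norm_resolvent_le in auto)

lemma norm_integral_le_const:
  fixes f :: "real \<Rightarrow> complex"
  assumes "\<And>x. cmod (f x) \<le> B"
  shows "cmod (integral\<^sup>L M f) \<le> B"
proof (cases "integrable M f")
  case True
  have "cmod (integral\<^sup>L M f) \<le> (LINT x|M. cmod (f x))" by (rule integral_norm_bound)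
  also have "\<dots> \<le> B" using True assms by (intro integral_le_const) auto
  finally show ?thesis .
next
  case False
  then show ?thesis using order_trans[OF norm_ge_zero assms] by (simp add: not_integrable_integral_eq)
qed

lemma norm_cauchy_transform_le: "Im z > 0 \<Longrightarrow> cmod (cauchy_transform M z) \<le> 1 / Im z"
  unfolding cauchy_transform_def by (rule norm_integral_le_const[OF norm_resolvent_le])

text \<open>
  The difference between the quotient and the derivative is a single integral of order \<open>w - z\<close>, by
  \<open>resolvent_difference\<close>, so no interchange of limits is needed.
\<close>

lemma cauchy_transform_has_derivative:
  assumes z: "Im z > 0"
  shows "(cauchy_transform M has_field_derivative - (LINT x|M. 1 / (z - of_real x)\<^sup>2)) (at z)"
proof -
  define y where "y = Im z"
  have y: "y > 0" using z by (simp add: y_def)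
  let ?G = "cauchy_transform M" and ?L = "- (LINT x|M. 1 / (z - of_real x)\<^sup>2)"
  have "((\<lambda>w. (?G w - ?G z) / (w - z)) \<longlongrightarrow> ?L) (at z)"
  proof (rule metric_tendsto_imp_tendsto)
    show "((\<lambda>w. of_real (1 / (y / 2 * y\<^sup>2)) * (w - z)) \<longlongrightarrow> 0) (at z)"
      using y by (auto intro!: tendsto_eq_intros)
    have "eventually (\<lambda>w. w \<in> {w. Im w > y / 2}) (at z)"
      by (rule eventually_at_in_open'[OF open_halfspace_Im_gt]) (use y in \<open>simp add: y_def\<close>)
    then show "eventually (\<lambda>w. dist ((?G w - ?G z) / (w - z)) ?L
        \<le> dist (of_real (1 / (y / 2 * y\<^sup>2)) * (w - z)) 0) (at z)"
      using eventually_neq_at_within[of z z UNIV]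
    proof eventually_elim
      case (elim w)
      have w: "Im w > y / 2" "Im w > 0" and wz: "w \<noteq> z" using elim y by auto
      have ne: "w - of_real x \<noteq> 0" "z - of_real x \<noteq> 0" for x
        using resolvent_ne_0 w z by auto
      have int2: "integrable M (\<lambda>x. 1 / (z - of_real x)\<^sup>2)"
      proof (rule integrable_const_bound[where B="(1 / Im z)\<^sup>2"])
        have "cmod (1 / (z - of_real x)\<^sup>2) \<le> (1 / Im z)\<^sup>2" for x
          using power_mono[OF norm_resolvent_le[OF z, of x], of 2] by (simp add: norm_divide norm_power power_divide)
        then show "AE x in M. cmod (1 / (z - of_real x)\<^sup>2) \<le> (1 / Im z)\<^sup>2" by simp
      qed simp
      have "(?G w - ?G z) / (w - z)
          = (LINT x|M. (1 / (w - of_real x) - 1 / (z - of_real x)) / (w - z))"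
        unfolding cauchy_transform_def using integrable_resolvent w z by simp
      then have "(?G w - ?G z) / (w - z) - ?L
          = (LINT x|M. (1 / (w - of_real x) - 1 / (z - of_real x)) / (w - z) + 1 / (z - of_real x)\<^sup>2)"
        using integrable_resolvent w z int2 by simp
      also have "\<dots> = (LINT x|M. (w - z) * (1 / (w - of_real x) * (1 / (z - of_real x))\<^sup>2))"
      proof (rule Bochner_Integration.integral_cong)
        fix x
        let ?a = "w - complex_of_real x" and ?b = "z - complex_of_real x"
        have a: "?a \<noteq> 0" "?b \<noteq> 0" "?a - ?b \<noteq> 0" using ne wz by auto
        have "(1 / ?a - 1 / ?b) / (?a - ?b) + 1 / ?b\<^sup>2 = (?a - ?b) * (1 / ?a * (1 / ?b)\<^sup>2)"
          by (rule resolvent_difference) (use a in auto)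
        then show "(1 / ?a - 1 / ?b) / (w - z) + 1 / ?b\<^sup>2 = (w - z) * (1 / ?a * (1 / ?b)\<^sup>2)" by simp
      qed simp
      also have "cmod \<dots> \<le> cmod (w - z) * (1 / (y / 2 * y\<^sup>2))"
      proof (rule norm_integral_le_const)
        fix x
        have "cmod (1 / (w - of_real x)) \<le> 1 / (y / 2)"
          by (rule order_trans[OF norm_resolvent_le[OF w(2)]]) (use w y in \<open>intro frac_le; simp\<close>)
        moreover have "cmod ((1 / (z - of_real x))\<^sup>2) \<le> (1 / y)\<^sup>2"
          unfolding norm_power using norm_resolvent_le[OF z, of x] by (intro power_mono) (auto simp: y_def)
        ultimately have "cmod (1 / (w - of_real x)) * cmod ((1 / (z - of_real x))\<^sup>2) \<le> 1 / (y / 2) * (1 / y)\<^sup>2"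
          using y by (intro mult_mono) auto
        then show "cmod ((w - z) * (1 / (w - of_real x) * (1 / (z - of_real x))\<^sup>2))
            \<le> cmod (w - z) * (1 / (y / 2 * y\<^sup>2))"
          unfolding norm_mult by (intro mult_left_mono) (auto simp: power_divide)
      qed
      finally have "cmod ((?G w - ?G z) / (w - z) - ?L) \<le> cmod (w - z) * \<bar>1 / (y / 2 * y\<^sup>2)\<bar>"
        by (rule order_trans) (intro mult_left_mono abs_ge_self norm_ge_zero)
      then show ?case
        by (simp only: dist_norm diff_0_right norm_mult norm_of_real mult.commute)
    qed
  qed
  then show ?thesis by (simp add: has_field_derivative_iff)
qed

lemma cauchy_transform_holomorphic: "cauchy_transform M holomorphic_on upper_half_plane"
  using cauchy_transform_has_derivative
  by (force simp: holomorphic_on_open[OF open_upper_half_plane] upper_half_plane_iff)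

lemma Im_cauchy_transform:
  assumes "Im z > 0"
  shows "Im (cauchy_transform M z) = - (LINT x|M. Im z / (cmod (z - of_real x))\<^sup>2)"
  using integral_Im[OF integrable_resolvent[OF assms]]
  by (simp add: cauchy_transform_def Im_resolvent)

lemma Im_cauchy_transform_neg:
  assumes z: "Im z > 0"
  shows "Im (cauchy_transform M z) < 0"
proof -
  have "expectation (\<lambda>x. Im (1 / (z - of_real x))) < 0"
    using resolvent_ne_0[OF z] z integrable_resolvent[OF z]
    by (intro expectation_less integrable_Im) (auto simp: Im_resolvent)
  then show ?thesis using integral_Im[OF integrable_resolvent[OF z]] by (simp add: cauchy_transform_def)
qed

text \<open>
  The squared modulus of a mean is at most the mean of the squared modulus, and
  \<open>\<bar>1 / (z - x)\<bar>\<^sup>2 Im z = - Im (1 / (z - x))\<close>.  This inequality is \<open>Im F(z) \<ge> Im z\<close>.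
\<close>

lemma norm_cauchy_transform_squared_le:
  assumes z: "Im z > 0"
  shows "(cmod (cauchy_transform M z))\<^sup>2 * Im z \<le> - Im (cauchy_transform M z)"
proof -
  let ?f = "\<lambda>x. 1 / (z - complex_of_real x)"
  have int: "integrable M (\<lambda>x. Re (?f x))" "integrable M (\<lambda>x. Im (?f x))"
    using integrable_resolvent[OF z] by auto
  have bnd: "cmod (?f x) ^ 2 \<le> (1 / Im z)\<^sup>2" for x
    using norm_resolvent_le[OF z] by (intro power_mono) auto
  have int2: "integrable M (\<lambda>x. (Re (?f x))\<^sup>2)" "integrable M (\<lambda>x. (Im (?f x))\<^sup>2)"
  proof -
    have "\<bar>(Re (?f x))\<^sup>2\<bar> \<le> (1 / Im z)\<^sup>2" "\<bar>(Im (?f x))\<^sup>2\<bar> \<le> (1 / Im z)\<^sup>2" for x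
      using bnd[of x] unfolding cmod_power2 by (smt (verit) zero_le_power2)+
    then show "integrable M (\<lambda>x. (Re (?f x))\<^sup>2)" "integrable M (\<lambda>x. (Im (?f x))\<^sup>2)"
      by (auto intro!: integrable_const_bound[where B="(1 / Im z)\<^sup>2"] simp del: Re_divide Im_divide)
  qed
  have eq: "Re (cauchy_transform M z) = expectation (\<lambda>x. Re (?f x))"
      "Im (cauchy_transform M z) = expectation (\<lambda>x. Im (?f x))"
    using integral_Re[OF integrable_resolvent[OF z]] integral_Im[OF integrable_resolvent[OF z]]
    by (simp_all add: cauchy_transform_def)
  have "(cmod (cauchy_transform M z))\<^sup>2 \<le> expectation (\<lambda>x. (Re (?f x))\<^sup>2) + expectation (\<lambda>x. (Im (?f x))\<^sup>2)"
    unfolding cmod_power2 eq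
    using variance_eq[OF int(1) int2(1)] variance_eq[OF int(2) int2(2)]
      variance_positive[of "\<lambda>x. Re (?f x)"] variance_positive[of "\<lambda>x. Im (?f x)"] by linarith
  also have "\<dots> = expectation (\<lambda>x. (cmod (?f x))\<^sup>2)"
    unfolding cmod_power2 using int2 by simp
  also have "(\<lambda>x. (cmod (?f x))\<^sup>2) = (\<lambda>x. (1 / Im z) * (Im z / (cmod (z - of_real x))\<^sup>2))"
    using z by (simp add: norm_divide power_divide)
  also have "expectation \<dots> = (1 / Im z) * (- Im (cauchy_transform M z))"
    unfolding Im_cauchy_transform[OF z] by (subst Bochner_Integration.integral_mult_right_zero) simp
  finally show ?thesis using z by (simp add: field_simps)
qed

text \<open>
  The integrand increases to 1 as \<open>y \<rightarrow> \<infinity>\<close>, so the right-hand side recovers the total mass in the limit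
  and controls the tails of \<open>M\<close> for fixed \<open>y\<close>.
\<close>

lemma integral_eq_Im_cauchy_transform:
  assumes y: "y > 0"
  shows "(LINT x|M. y\<^sup>2 / (x\<^sup>2 + y\<^sup>2)) = - y * Im (cauchy_transform M (\<i> * of_real y))"
proof -
  have "(LINT x|M. y\<^sup>2 / (x\<^sup>2 + y\<^sup>2)) = (LINT x|M. y * (y / (x\<^sup>2 + y\<^sup>2)))"
    by (simp only: power2_eq_square times_divide_eq_right)
  also have "\<dots> = y * (LINT x|M. y / (x\<^sup>2 + y\<^sup>2))" by (rule integral_mult_right_zero)
  finally show ?thesis using Im_cauchy_transform[of "\<i> * of_real y"] y by (simp add: cmod_power2)
qed

lemma cauchy_transform_asymptotics:
  "((\<lambda>y. - y * Im (cauchy_transform M (\<i> * of_real y))) \<longlongrightarrow> 1) at_top"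
proof -
  have "((\<lambda>y. LINT x|M. y\<^sup>2 / (x\<^sup>2 + y\<^sup>2)) \<longlongrightarrow> (LINT x|M. 1)) at_top"
  proof (rule integral_dominated_convergence_at_top[where w="\<lambda>_. 1"])
    show "AE x in M. ((\<lambda>y. y\<^sup>2 / (x\<^sup>2 + y\<^sup>2)) \<longlongrightarrow> 1) at_top"
      by (rule AE_I2) real_asymp
    show "eventually (\<lambda>y. AE x in M. norm (y\<^sup>2 / (x\<^sup>2 + y\<^sup>2)) \<le> 1) at_top"
      using eventually_gt_at_top[of 0]
      by eventually_elim (intro AE_I2, simp add: divide_le_eq_1 add_nonneg_pos)
  qed auto
  moreover have "eventually (\<lambda>y. (LINT x|M. y\<^sup>2 / (x\<^sup>2 + y\<^sup>2)) = - y * Im (cauchy_transform M (\<i> * of_real y))) at_top"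
    using eventually_gt_at_top[of 0] by eventually_elim (rule integral_eq_Im_cauchy_transform)
  ultimately have "((\<lambda>y. - y * Im (cauchy_transform M (\<i> * of_real y))) \<longlongrightarrow> (LINT x|M. 1)) at_top"
    by (rule Lim_transform_eventually)
  then show ?thesis using prob_space by simp
qed

theorem F_transform_in_F_class: "F_transform M \<in> F_class"
proof -
  let ?G = "cauchy_transform M"
  have ne: "?G z \<noteq> 0" if "Im z > 0" for z using Im_cauchy_transform_neg[OF that] by auto
  have Im_F: "Im (F_transform M z) = - Im (?G z) / (cmod (?G z))\<^sup>2" for z
    by (simp add: F_transform_def Im_divide')
  have hol: "F_transform M holomorphic_on upper_half_plane"
    unfolding F_transform_def[abs_def] using ne
    by (intro holomorphic_intros cauchy_transform_holomorphic) (auto simp: upper_half_plane_iff)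
  have ge: "Im (F_transform M z) \<ge> Im z" if "Im z > 0" for z
    unfolding Im_F using norm_cauchy_transform_squared_le[OF that] ne[OF that]
    by (simp add: field_simps)
  have "((\<lambda>y. Im (F_transform M (\<i> * of_real y) - \<i> * of_real y) / y) \<longlongrightarrow> 0) at_top"
  proof (rule tendsto_sandwich)
    show "eventually (\<lambda>y. 0 \<le> Im (F_transform M (\<i> * of_real y) - \<i> * of_real y) / y) at_top"
      using eventually_gt_at_top[of 0]
    proof eventually_elim
      case (elim y)
      then show ?case using ge[of "\<i> * of_real y"] by simp
    qed
    show "((\<lambda>y. 1 / (- y * Im (?G (\<i> * of_real y))) - 1) \<longlongrightarrow> 0) at_top"
      using tendsto_diff[OF tendsto_divide[OF tendsto_const[of 1] cauchy_transform_asymptotics] tendsto_const[of 1]]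
      by simp
    show "eventually (\<lambda>y. Im (F_transform M (\<i> * of_real y) - \<i> * of_real y) / y
        \<le> 1 / (- y * Im (?G (\<i> * of_real y))) - 1) at_top"
      using eventually_gt_at_top[of 0]
    proof eventually_elim
      case (elim y)
      define g where "g = - Im (?G (\<i> * of_real y))"
      have g: "g > 0" using Im_cauchy_transform_neg[of "\<i> * of_real y"] elim by (simp add: g_def)
      have "g\<^sup>2 \<le> (cmod (?G (\<i> * of_real y)))\<^sup>2" unfolding cmod_power2 by (simp add: g_def)
      then have "Im (F_transform M (\<i> * of_real y)) \<le> g / g\<^sup>2"
        unfolding Im_F g_def[symmetric] using g ne[of "\<i> * of_real y"] elim
        by (intro divide_left_mono mult_pos_pos) simp_all
      also have "\<dots> = 1 / g" using g by (simp add: power2_eq_square)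
      finally have "Im (F_transform M (\<i> * of_real y)) / y \<le> 1 / g / y"
        using elim by (intro divide_right_mono) auto
      then show ?case using elim by (simp add: diff_divide_distrib g_def mult.commute)
    qed
  qed simp
  then have "sublinear (\<lambda>z. F_transform M z - z)" by (rule sublinear_if_tendsto)
  moreover have "pick_function (\<lambda>z. F_transform M z - z)"
    using hol ge by (auto simp: pick_function_def upper_half_plane_iff intro!: holomorphic_intros)
  ultimately show ?thesis by (simp add: F_class_iff)
qed

end

section \<open>The measure is determined by its transform\<close>

text \<open>
  The Poisson kernel of the half-plane, which is also the density of the Cauchy distribution of
  scale \<open>y\<close>.
\<close>

definition poisson_kernel :: "real \<Rightarrow> real \<Rightarrow> real" where
  "poisson_kernel y x = y / (pi * (x\<^sup>2 + y\<^sup>2))"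

lemma poisson_kernel_nonneg: "y > 0 \<Longrightarrow> poisson_kernel y x \<ge> 0"
  by (simp add: poisson_kernel_def)

lemma poisson_kernel_measurable [measurable]:
  "(\<lambda>x. poisson_kernel (f x) (g x)) \<in> borel_measurable M"
  if "f \<in> borel_measurable M" "g \<in> borel_measurable M"
  using that unfolding poisson_kernel_def by measurable

lemma has_bochner_integral_poisson_kernel_1: "has_bochner_integral lborel (poisson_kernel 1) 1"
proof -
  have "poisson_kernel 1 = (\<lambda>x. (1 / pi) * inverse (1 + x\<^sup>2))"
    by (auto simp: poisson_kernel_def field_simps)
  moreover have "has_bochner_integral lborel (\<lambda>x. inverse (1 + x\<^sup>2 :: real)) pi"
    using integrable_inverse_1_plus_square LBINT_inverse_1_plus_square
    by (simp add: has_bochner_integral_iff set_integrable_def interval_lebesgue_integral_def set_lebesgue_integral_def)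
  ultimately show ?thesis
    using has_bochner_integral_mult_right[of "1 / pi" lborel "\<lambda>x. inverse (1 + x\<^sup>2)" pi] by simp
qed

lemma poisson_kernel_scale:
  assumes "y > 0" shows "y * poisson_kernel y (y * v) = poisson_kernel 1 v"
proof -
  have "pi * ((y * v)\<^sup>2 + y\<^sup>2) = y\<^sup>2 * (pi * (v\<^sup>2 + 1))"
    by (simp add: power_mult_distrib algebra_simps)
  then show ?thesis using assms by (simp add: poisson_kernel_def power2_eq_square)
qed

lemma has_bochner_integral_poisson_kernel:
  assumes y: "y > 0"
  shows "has_bochner_integral lborel (\<lambda>x. poisson_kernel y (x - t)) 1"
proof -
  have "has_bochner_integral lborel (\<lambda>v. poisson_kernel y ((t + y * v) - t)) (1 /\<^sub>R y)"
  proof -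
    have "(\<lambda>v. poisson_kernel y ((t + y * v) - t)) = (\<lambda>v. 1 / y * poisson_kernel 1 v)"
      using y by (auto simp: poisson_kernel_scale[OF y, symmetric])
    then show ?thesis
      using has_bochner_integral_mult_right[where c="1 / y", OF has_bochner_integral_poisson_kernel_1]
      by (simp add: divide_inverse)
  qed
  then show ?thesis
    using lborel_has_bochner_integral_real_affine_iff[of y "\<lambda>x. poisson_kernel y (x - t)" 1 t] y
    by simp
qed

lemma integrable_poisson_kernel: "y > 0 \<Longrightarrow> integrable lborel (\<lambda>x. poisson_kernel y (x - t))"
  using has_bochner_integral_poisson_kernel by (auto simp: has_bochner_integral_iff)

definition cauchy_distribution :: "real measure" where
  "cauchy_distribution = density lborel (poisson_kernel 1)"

lemma real_distribution_density:
  assumes [measurable]: "u \<in> borel_measurable lborel" and u: "\<And>x. u x \<ge> 0"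
    and int: "has_bochner_integral lborel u (1::real)"
  shows "real_distribution (density lborel u)"
proof -
  have "emeasure (density lborel u) (space (density lborel u)) = (\<integral>\<^sup>+ x. ennreal (u x) \<partial>lborel)"
    by (simp add: emeasure_density)
  also have "\<dots> = 1"
    using int nn_integral_eq_integral[of lborel u] u by (auto simp: has_bochner_integral_iff)
  finally have "prob_space (density lborel u)" by (rule prob_spaceI)
  then show ?thesis by (simp add: real_distribution_def real_distribution_axioms_def)
qed

lemma real_distribution_cauchy: "real_distribution cauchy_distribution"
  unfolding cauchy_distribution_def
  by (rule real_distribution_density)
     (auto simp: poisson_kernel_nonneg has_bochner_integral_poisson_kernel_1)

text \<open>
  Substitute \<open>x = t + y v\<close>.
\<close>

lemma fourier_poisson_kernel:
  assumes y: "y > 0"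
  shows "(CLINT x|lborel. poisson_kernel y (x - t) *\<^sub>R iexp (s * x)) = iexp (s * t) * char cauchy_distribution (y * s)"
proof -
  have "(CLINT x|lborel. poisson_kernel y (x - t) *\<^sub>R iexp (s * x))
      = \<bar>y\<bar> *\<^sub>R (CLINT v|lborel. poisson_kernel y ((t + y * v) - t) *\<^sub>R iexp (s * (t + y * v)))"
    by (rule lborel_integral_real_affine) (use y in simp)
  also have "\<dots> = (CLINT v|lborel. y *\<^sub>R (poisson_kernel y ((t + y * v) - t) *\<^sub>R iexp (s * (t + y * v))))"
    unfolding abs_of_pos[OF y] by (rule integral_scaleR_right[symmetric])
  also have "\<dots> = (CLINT v|lborel. iexp (s * t) * (poisson_kernel 1 v *\<^sub>R iexp ((y * s) * v)))"
  proof (rule Bochner_Integration.integral_cong[OF refl])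
    fix v
    have 1: "y *\<^sub>R (poisson_kernel y ((t + y * v) - t) *\<^sub>R iexp (s * (t + y * v)))
        = poisson_kernel 1 v *\<^sub>R iexp (s * (t + y * v))"
      using poisson_kernel_scale[OF y, of v] by simp
    have 2: "iexp (s * (t + y * v)) = iexp (s * t) * iexp ((y * s) * v)"
      by (simp add: exp_add[symmetric] algebra_simps)
    show "y *\<^sub>R (poisson_kernel y ((t + y * v) - t) *\<^sub>R iexp (s * (t + y * v)))
        = iexp (s * t) * (poisson_kernel 1 v *\<^sub>R iexp ((y * s) * v))"
      unfolding 1 unfolding 2 by (simp only: mult_scaleR_right)
  qed
  also have "\<dots> = iexp (s * t) * (CLINT v|lborel. poisson_kernel 1 v *\<^sub>R iexp ((y * s) * v))"
    by (rule integral_mult_right_zero)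
  also have "(CLINT v|lborel. poisson_kernel 1 v *\<^sub>R iexp ((y * s) * v)) = char cauchy_distribution (y * s)"
    unfolding char_def cauchy_distribution_def
    by (subst integral_density) (auto simp: poisson_kernel_nonneg)
  finally show ?thesis .
qed

context real_distribution
begin

text \<open>
  The left-hand side is the density of the convolution of \<open>M\<close> with a Cauchy distribution of scale \<open>y\<close>.
\<close>

lemma poisson_integral_eq:
  assumes y: "y > 0"
  shows "(LINT t|M. poisson_kernel y (x - t)) = - Im (cauchy_transform M (Complex x y)) / pi"
proof -
  have "(LINT t|M. poisson_kernel y (x - t)) = (LINT t|M. (1 / pi) * (y / (cmod (Complex x y - of_real t))\<^sup>2))"
    by (rule Bochner_Integration.integral_cong) (simp_all add: poisson_kernel_def cmod_power2)
  also have "\<dots> = (1 / pi) * (LINT t|M. y / (cmod (Complex x y - of_real t))\<^sup>2)"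
    by (rule integral_mult_right_zero)
  finally show ?thesis using Im_cauchy_transform[of "Complex x y"] y by simp
qed

text \<open>
  The right-hand side depends on \<open>M\<close> only through its Cauchy transform.  The equation is Fubini's
  theorem for the Fourier transform of the convolution with a Cauchy distribution.
\<close>

lemma char_times_cauchy:
  assumes y: "y > 0"
  shows "char M s * char cauchy_distribution (y * s)
    = (CLINT x|lborel. of_real (- Im (cauchy_transform M (Complex x y)) / pi) * iexp (s * x))"
proof -
  interpret P: pair_sigma_finite M lborel ..
  let ?f = "\<lambda>t x. poisson_kernel y (x - t) *\<^sub>R iexp (s * x)"
  have [measurable]: "case_prod ?f \<in> borel_measurable (M \<Otimes>\<^sub>M lborel)" by measurable
  have norm_f: "cmod (?f t x) = poisson_kernel y (x - t)" for t x
    using poisson_kernel_nonneg[OF y] by simp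
  have "integrable (M \<Otimes>\<^sub>M lborel) (case_prod ?f)"
  proof (rule P.Fubini_integrable)
    have "(LINT x|lborel. cmod (case_prod ?f (t, x))) = 1" for t
      using has_bochner_integral_poisson_kernel[OF y, of t] norm_f
      by (simp add: has_bochner_integral_iff)
    then show "integrable M (\<lambda>t. LINT x|lborel. cmod (case_prod ?f (t, x)))" by simp
    show "AE t in M. complex_integrable lborel (\<lambda>x. case_prod ?f (t, x))"
    proof (rule AE_I2)
      fix t
      show "complex_integrable lborel (\<lambda>x. case_prod ?f (t, x))"
        by (rule Bochner_Integration.integrable_bound[OF integrable_poisson_kernel[OF y, of t]])
           (use norm_f poisson_kernel_nonneg[OF y] in auto)
    qed
  qed simp
  from P.Fubini_integral[OF this]
  have "(CLINT x|lborel. CLINT t|M. ?f t x) = (CLINT t|M. CLINT x|lborel. ?f t x)" .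
  also have "\<dots> = (CLINT t|M. iexp (s * t) * char cauchy_distribution (y * s))"
    unfolding fourier_poisson_kernel[OF y] ..
  also have "\<dots> = char M s * char cauchy_distribution (y * s)"
    unfolding char_def[of M] by (rule integral_mult_left_zero)
  also have "(CLINT x|lborel. CLINT t|M. ?f t x)
      = (CLINT x|lborel. of_real (- Im (cauchy_transform M (Complex x y)) / pi) * iexp (s * x))"
  proof (rule Bochner_Integration.integral_cong[OF refl])
    fix x
    have "(CLINT t|M. ?f t x) = (CLINT t|M. of_real (poisson_kernel y (x - t)) * iexp (s * x))"
      by (simp add: scaleR_conv_of_real)
    also have "\<dots> = (CLINT t|M. of_real (poisson_kernel y (x - t))) * iexp (s * x)"
      by (rule integral_mult_left_zero)
    also have "(CLINT t|M. of_real (poisson_kernel y (x - t))) = of_real (LINT t|M. poisson_kernel y (x - t))"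
      by (rule integral_complex_of_real)
    finally show "(CLINT t|M. ?f t x) = of_real (- Im (cauchy_transform M (Complex x y)) / pi) * iexp (s * x)"
      unfolding poisson_integral_eq[OF y] .
  qed
  finally show ?thesis ..
qed

end

text \<open>
  For given \<open>s\<close> the factor \<open>char cauchy_distribution (y * s)\<close> is nonzero once \<open>y\<close> is small, so it cancels
  and the characteristic functions agree.
\<close>

theorem F_transform_inj:
  assumes M: "real_distribution M" and N: "real_distribution N"
    and eq: "\<And>z. z \<in> upper_half_plane \<Longrightarrow> F_transform M z = F_transform N z"
  shows "M = N"
proof (rule Levy_uniqueness[OF M N], rule ext)
  fix s
  interpret C: real_distribution cauchy_distribution by (rule real_distribution_cauchy)
  have G: "cauchy_transform M z = cauchy_transform N z" if "Im z > 0" for z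
    using eq[of z] that by (auto simp: F_transform_def upper_half_plane_iff)
  have "((\<lambda>y. char cauchy_distribution (y * s)) \<longlongrightarrow> char cauchy_distribution (0 * s)) (at_right 0)"
    by (rule isCont_tendsto_compose[OF C.isCont_char]) (intro tendsto_intros)
  then have "eventually (\<lambda>y. char cauchy_distribution (y * s) \<noteq> 0) (at_right 0)"
    by (intro tendsto_imp_eventually_ne[of _ "char cauchy_distribution (0 * s)"]) (simp_all add: C.char_zero)
  then have "eventually (\<lambda>y. char cauchy_distribution (y * s) \<noteq> 0 \<and> y > 0) (at_right 0)"
    using eventually_at_right_less[of 0] by eventually_elim simp
  then obtain y where y: "char cauchy_distribution (y * s) \<noteq> 0" "y > 0"
    using eventually_happens'[OF trivial_limit_at_right_real] by blast
  have "char M s * char cauchy_distribution (y * s) = char N s * char cauchy_distribution (y * s)"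
    unfolding real_distribution.char_times_cauchy[OF M y(2)] real_distribution.char_times_cauchy[OF N y(2)]
    using G y by simp
  then show "char M s = char N s" using y by simp
qed

section \<open>The Poisson formula for the half-plane\<close>

text \<open>
  Cauchy's theorem on half-disks: the integral over \<open>[-R, R]\<close> is minus the integral over the
  semicircle of radius \<open>R\<close>, which is \<open>O(1/R)\<close>.  A primitive on the convex domain takes the place of the
  closed contour.
\<close>

lemma integral_real_line_eq_0_if_decay:
  assumes e: "e > 0" and hol: "q holomorphic_on {w. Im w > - e}"
    and decay: "\<And>w. Im w \<ge> 0 \<Longrightarrow> cmod w \<ge> R0 \<Longrightarrow> cmod (q w) \<le> C / (cmod w)\<^sup>2" and C: "C \<ge> 0"
    and int: "integrable lborel (\<lambda>t. q (of_real t))"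
  shows "(LINT t|lborel. q (of_real t)) = 0"
proof -
  let ?S = "{w. Im w > - e}"
  obtain Q where Q: "\<And>w. w \<in> ?S \<Longrightarrow> (Q has_field_derivative q w) (at w within ?S)"
    using holomorphic_convex_primitive'[OF convex_halfspace_Im_gt open_halfspace_Im_gt hol] by blast
  then have Q_at: "(Q has_field_derivative q w) (at w)" if "w \<in> ?S" for w
    using that at_within_open[OF that open_halfspace_Im_gt] by metis
  have cont: "continuous_on ?S q" by (rule holomorphic_on_imp_continuous_on[OF hol])
  let ?I = "\<lambda>R::real. LINT t|lborel. indicator {-R..R} t *\<^sub>R q (of_real t)"
  have I: "?I R = Q (of_real R) - Q (of_real (-R))" if "R > 0" for R
  proof -
    have "((\<lambda>t. Q (of_real t)) has_vector_derivative q (of_real t)) (at t within {-R..R})" for t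
      using e by (intro has_vector_derivative_real_field Q_at has_vector_derivative_at_within) auto
    moreover have "continuous_on {-R..R} (\<lambda>t. q (of_real t))"
      using e by (intro continuous_on_compose2[OF cont] continuous_intros) auto
    ultimately show ?thesis using that by (intro integral_FTC_atLeastAtMost) auto
  qed
  have arc: "cmod (?I R) \<le> C * pi / R" if R: "R > 0" "R \<ge> R0" for R
  proof -
    let ?g = "part_circlepath 0 R 0 pi"
    have img: "w \<in> ?S \<and> Im w \<ge> 0 \<and> cmod w = R" if w: "w \<in> path_image ?g" for w
    proof -
      obtain t where "t \<in> {0..pi}" "w = of_real R * cis t"
        using w by (auto simp: path_image_part_circlepath' closed_segment_eq_real_ivl)
      then show ?thesis using R e sin_ge_zero[of t]
        by (auto simp: norm_mult intro: less_le_trans[of _ 0])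
    qed
    have "(q has_contour_integral (Q (pathfinish ?g) - Q (pathstart ?g))) ?g"
      by (rule contour_integral_primitive[of ?S]) (use Q img in auto)
    moreover have "pathfinish ?g = of_real (-R)" "pathstart ?g = of_real R"
      by (simp_all add: exp_pi_i)
    ultimately have ci: "(q has_contour_integral - ?I R) ?g"
      by (simp add: I[OF R(1)])
    have "cmod (contour_integral ?g q) \<le> C / R\<^sup>2 * R * \<bar>pi - 0\<bar>"
    proof (rule contour_integral_bound_part_circlepath)
      show "q contour_integrable_on ?g" using ci by (auto simp: contour_integrable_on_def)
      show "cmod (q w) \<le> C / R\<^sup>2" if "w \<in> path_image ?g" for w
        using decay[of w] img[OF that] R by auto
    qed (use C R in auto)
    then show ?thesis using contour_integral_unique[OF ci] R by (simp add: power2_eq_square)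
  qed
  have "(?I \<longlongrightarrow> (LINT t|lborel. q (of_real t))) at_top"
  proof (rule integral_dominated_convergence_at_top[where w="\<lambda>t. cmod (q (of_real t))"])
    show "AE t in lborel. ((\<lambda>R. indicator {-R..R} t *\<^sub>R q (of_real t)) \<longlongrightarrow> q (of_real t)) at_top"
    proof (rule AE_I2)
      fix t :: real
      have "eventually (\<lambda>R. q (of_real t) = indicator {-R..R} t *\<^sub>R q (of_real t)) at_top"
        using eventually_ge_at_top[of "\<bar>t\<bar>"] by eventually_elim (simp add: abs_le_iff)
      then show "((\<lambda>R. indicator {-R..R} t *\<^sub>R q (of_real t)) \<longlongrightarrow> q (of_real t)) at_top"
        by (rule Lim_transform_eventually[OF tendsto_const])
    qed
    show "eventually (\<lambda>R. AE t in lborel. norm (indicator {-R..R} t *\<^sub>R q (of_real t)) \<le> cmod (q (of_real t))) at_top"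
      by (intro always_eventually allI AE_I2) (auto split: split_indicator)
  qed (use int in auto)
  moreover have "(?I \<longlongrightarrow> 0) at_top"
  proof (rule Lim_null_comparison)
    show "eventually (\<lambda>R. norm (?I R) \<le> C * pi / R) at_top"
      using eventually_gt_at_top[of 0] eventually_ge_at_top[of R0] by eventually_elim (rule arc)
    show "((\<lambda>R. C * pi / R) \<longlongrightarrow> 0) at_top"
      by (rule tendsto_divide_0[OF tendsto_const filterlim_at_top_imp_at_infinity[OF filterlim_ident]])
  qed
  ultimately show ?thesis using tendsto_unique[OF trivial_limit_at_top_linorder] by blast
qed

lemma diff_times_diff_cnj_eq:
  "(complex_of_real t - z) * (of_real t - cnj z) = of_real ((t - Re z)\<^sup>2 + (Im z)\<^sup>2)"
  using complex_mult_cnj[of "complex_of_real t - z"] by simp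

text \<open>
  For real \<open>t\<close> the Poisson kernel at \<open>z\<close> is a multiple of \<open>1 / ((t - z)(t - cnj z))\<close>.  Subtracting the
  constant \<open>f z\<close> from \<open>f\<close> removes the pole at \<open>z\<close>, so that the integral of
  \<open>(f t - f z) / ((t - z)(t - cnj z))\<close> vanishes by Cauchy's theorem; boundedness of \<open>f\<close> suffices, as
  the kernel decays quadratically.
\<close>

theorem poisson_formula_half_plane:
  assumes e: "e > 0" and hol: "f holomorphic_on {w. Im w > - e}"
    and bdd: "\<And>w. Im w \<ge> 0 \<Longrightarrow> cmod (f w) \<le> B" and z: "Im z > 0"
  shows "has_bochner_integral lborel (\<lambda>t. poisson_kernel (Im z) (t - Re z) *\<^sub>R f (of_real t)) (f z)"
proof -
  define y where "y = Im z"
  have y: "y > 0" using z by (simp add: y_def)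
  have B: "B \<ge> 0" using order_trans[OF norm_ge_zero bdd[of 0]] by simp
  \<comment> \<open>Below the real line the domain has to avoid the remaining pole \<open>cnj z\<close>.\<close>
  define e' where "e' = min e y"
  have e': "e' > 0" using e y by (simp add: e'_def)
  let ?S = "{w. Im w > - e'}"
  define d where "d = (\<lambda>w. if w = z then deriv f z else (f w - f z) / (w - z))"
  define q where "q = (\<lambda>w. d w / (w - cnj z))"
  have "d holomorphic_on ?S" unfolding d_def
    by (rule pole_lemma_open[OF holomorphic_on_subset[OF hol] open_halfspace_Im_gt]) (auto simp: e'_def)
  then have q_hol: "q holomorphic_on ?S"
    unfolding q_def by (rule holomorphic_on_divide) (auto intro!: holomorphic_intros simp: e'_def y_def)
  have q_decay: "cmod (q w) \<le> (8 * B) / (cmod w)\<^sup>2" if w: "Im w \<ge> 0" "cmod w \<ge> 3 * cmod z" for w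
  proof -
    have z0: "cmod z > 0" using z by (auto simp: complex_eq_iff)
    have wz: "w \<noteq> z" using w z0 by auto
    have "cmod (w - z) \<ge> cmod w - cmod z" "cmod (w - cnj z) \<ge> cmod w - cmod z"
      using norm_triangle_ineq2[of w z] norm_triangle_ineq2[of w "cnj z"] by simp_all
    then have a: "cmod (w - z) \<ge> cmod w / 2" "cmod (w - cnj z) \<ge> cmod w / 2"
      using w z0 by linarith+
    have w0: "cmod w > 0" using w z0 by linarith
    have "cmod (q w) = cmod (f w - f z) / (cmod (w - z) * cmod (w - cnj z))"
      using wz by (simp add: q_def d_def norm_divide norm_mult)
    also have "\<dots> \<le> (B + B) / ((cmod w / 2) * (cmod w / 2))"
    proof (rule frac_le)
      show "cmod (f w - f z) \<le> B + B"
        by (rule order_trans[OF norm_triangle_ineq4]) (intro add_mono bdd, use w z in auto)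
      show "(cmod w / 2) * (cmod w / 2) \<le> cmod (w - z) * cmod (w - cnj z)"
        using a by (intro mult_mono) auto
      show "0 < (cmod w / 2) * (cmod w / 2)" using w0 by simp
    qed (use B in auto)
    also have "\<dots> = (8 * B) / (cmod w)\<^sup>2" by (simp add: power2_eq_square)
    finally show ?thesis .
  qed
  let ?P = "\<lambda>t. poisson_kernel y (t - Re z)"
  have q_real: "q (of_real t) = (pi / y * ?P t) *\<^sub>R (f (of_real t) - f z)" for t
  proof -
    have "of_real t \<noteq> z" using z by auto
    then have "q (of_real t) = (f (of_real t) - f z) / ((of_real t - z) * (of_real t - cnj z))"
      by (simp add: q_def d_def)
    also have "\<dots> = (1 / ((t - Re z)\<^sup>2 + y\<^sup>2)) *\<^sub>R (f (of_real t) - f z)"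
      unfolding diff_times_diff_cnj_eq y_def[symmetric]
      by (simp only: scaleR_conv_of_real of_real_divide of_real_1) simp
    also have "1 / ((t - Re z)\<^sup>2 + y\<^sup>2) = pi / y * ?P t"
      using y by (simp add: poisson_kernel_def)
    finally show ?thesis .
  qed
  have P_int: "integrable lborel ?P" "(LINT t|lborel. ?P t) = 1"
    using has_bochner_integral_poisson_kernel[OF y, of "Re z"] by (auto simp: has_bochner_integral_iff)
  have "continuous_on UNIV (\<lambda>t. f (complex_of_real t))"
    using e by (intro continuous_on_compose2[OF holomorphic_on_imp_continuous_on[OF hol]] continuous_intros) auto
  then have f_meas [measurable]: "(\<lambda>t. f (complex_of_real t)) \<in> borel_measurable borel"
    by (rule borel_measurable_continuous_onI)
  have int_f: "integrable lborel (\<lambda>t. ?P t *\<^sub>R f (of_real t))"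
  proof (rule Bochner_Integration.integrable_bound)
    show "integrable lborel (\<lambda>t. B * ?P t)" using P_int by simp
    have "?P t * cmod (f (of_real t)) \<le> B * ?P t" for t
      using mult_right_mono[OF bdd[of "of_real t"] poisson_kernel_nonneg[OF y, of "t - Re z"]]
      by (simp add: mult.commute)
    then show "AE t in lborel. norm (?P t *\<^sub>R f (of_real t)) \<le> norm (B * ?P t)"
      using poisson_kernel_nonneg[OF y] B by (intro AE_I2) simp
  qed simp
  have int_c: "integrable lborel (\<lambda>t. ?P t *\<^sub>R f z)" using P_int by simp
  have q_eq: "(\<lambda>t. q (of_real t)) = (\<lambda>t. (pi / y) *\<^sub>R (?P t *\<^sub>R f (of_real t) - ?P t *\<^sub>R f z))"
    unfolding q_real by (simp add: scaleR_diff_right)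
  have "(LINT t|lborel. q (of_real t)) = 0"
  proof (rule integral_real_line_eq_0_if_decay[OF e' q_hol q_decay])
    show "integrable lborel (\<lambda>t. q (of_real t))" unfolding q_eq using int_f int_c by simp
  qed (use B in auto)
  then have "(LINT t|lborel. ?P t *\<^sub>R f (of_real t) - ?P t *\<^sub>R f z) = 0"
    unfolding q_eq using y by simp
  then have "(LINT t|lborel. ?P t *\<^sub>R f (of_real t)) = f z"
    using int_f int_c P_int by simp
  with int_f show ?thesis by (simp add: has_bochner_integral_iff y_def)
qed

section \<open>Every member of the class is a transform\<close>

text \<open>
  A special case of the open mapping theorem; Schwarz-Pick gives it at once.
\<close>

lemma pick_Im_zero_imp_constant:
  assumes "pick_function h" "\<And>z. Im z > 0 \<Longrightarrow> Im (h z) = 0" "Im z > 0" "Im w > 0"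
  shows "h z = h w"
proof -
  have "(cmod (h z - h w))\<^sup>2 * (Im z * Im w) \<le> 0"
    using schwarz_pick[OF assms(1,3,4)] assms by simp
  moreover have "Im z * Im w > 0" using assms by simp
  ultimately have "(cmod (h z - h w))\<^sup>2 \<le> 0" by (meson linorder_not_le mult_pos_pos)
  then show ?thesis by simp
qed

text \<open>
  The candidate density is \<open>u t = - Im G(t + i\<epsilon>) / \<pi>\<close>.  By the Poisson formula, \<open>- Im G(z + i\<epsilon>)\<close> is
  \<open>\<pi>\<close> times the Poisson integral of \<open>u\<close>.  Evaluated at \<open>z = iy\<close> and multiplied by \<open>y\<close>, this shows as
  \<open>y \<rightarrow> \<infinity>\<close> that \<open>u\<close> has mass 1; evaluated at general \<open>z\<close>, it shows that the Cauchy transform of the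
  measure with density \<open>u\<close> has the same imaginary part as \<open>G(z + i\<epsilon>)\<close>.  The two then differ by a
  constant, which is 0 because both vanish at infinity.
\<close>

lemma shifted_function_is_cauchy_transform:
  assumes hol: "G holomorphic_on upper_half_plane"
    and bdd: "\<And>z. Im z > 0 \<Longrightarrow> cmod (G z) \<le> 1 / Im z"
    and neg: "\<And>z. Im z > 0 \<Longrightarrow> Im (G z) \<le> 0"
    and lim: "((\<lambda>y. - y * Im (G (\<i> * of_real y))) \<longlongrightarrow> 1) at_top"
    and \<epsilon>: "\<epsilon> > 0"
  shows "\<exists>\<rho>. real_distribution \<rho> \<and> (\<forall>z. Im z > 0 \<longrightarrow> cauchy_transform \<rho> z = G (z + \<i> * of_real \<epsilon>))"
proof -
  define f where "f = (\<lambda>w. G (w + \<i> * of_real \<epsilon>))"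
  define u where "u = (\<lambda>t. - Im (f (of_real t)) / pi)"
  have f_hol: "f holomorphic_on {w. Im w > - \<epsilon>}"
    unfolding f_def
    by (rule holomorphic_on_compose_gen[of "\<lambda>w. w + \<i> * of_real \<epsilon>" _ G, unfolded o_def, OF _ hol])
       (auto intro!: holomorphic_intros simp: upper_half_plane_iff)
  have f_bdd: "cmod (f w) \<le> 1 / \<epsilon>" if "Im w \<ge> 0" for w
  proof -
    have "cmod (f w) \<le> 1 / Im (w + \<i> * of_real \<epsilon>)" unfolding f_def using that \<epsilon> by (intro bdd) simp
    also have "\<dots> \<le> 1 / \<epsilon>" using that \<epsilon> by (intro divide_left_mono) auto
    finally show ?thesis .
  qed
  have u_nonneg: "u t \<ge> 0" for t
    using neg[of "of_real t + \<i> * of_real \<epsilon>"] \<epsilon> by (simp add: u_def f_def divide_le_0_iff)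
  have "continuous_on UNIV (\<lambda>t. f (complex_of_real t))"
    using \<epsilon> by (intro continuous_on_compose2[OF holomorphic_on_imp_continuous_on[OF f_hol]] continuous_intros) auto
  then have [measurable]: "(\<lambda>t. f (complex_of_real t)) \<in> borel_measurable borel"
    by (rule borel_measurable_continuous_onI)
  have u_meas [measurable]: "u \<in> borel_measurable borel" unfolding u_def by measurable
  have poisson: "has_bochner_integral lborel (\<lambda>t. poisson_kernel (Im z) (t - Re z) * u t) (- Im (f z) / pi)"
    if z: "Im z > 0" for z
  proof -
    have "has_bochner_integral lborel (\<lambda>t. Im (poisson_kernel (Im z) (t - Re z) *\<^sub>R f (of_real t))) (Im (f z))"
      by (rule has_bochner_integral_Im[OF poisson_formula_half_plane[OF \<epsilon> f_hol f_bdd z]])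
    from has_bochner_integral_mult_right[where c="- 1 / pi", OF this]
    show ?thesis by (simp add: u_def mult.commute)
  qed
  have u_int: "has_bochner_integral lborel u 1"
  proof -
    define \<phi> where "\<phi> = (\<lambda>n t. (real (Suc n))\<^sup>2 / (t\<^sup>2 + (real (Suc n))\<^sup>2) * u t)"
    have \<phi>_int: "has_bochner_integral lborel (\<phi> n) (- real (Suc n) * Im (f (\<i> * of_real (real (Suc n)))))" for n
    proof -
      define y where "y = real (Suc n)"
      have y: "y > 0" by (simp add: y_def)
      have "\<phi> n = (\<lambda>t. (pi * y) * (poisson_kernel y t * u t))"
        unfolding \<phi>_def y_def[symmetric] poisson_kernel_def by (auto simp: power2_eq_square)
      then show ?thesis
        unfolding y_def[symmetric]
        using has_bochner_integral_mult_right[where c="pi * y", OF poisson[of "\<i> * of_real y"]] y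
        by (simp add: mult_ac)
    qed
    show ?thesis
    proof (rule has_bochner_integral_monotone_convergence)
      show "integrable lborel (\<phi> n)" for n using \<phi>_int by (auto simp: has_bochner_integral_iff)
      show "AE t in lborel. mono (\<lambda>n. \<phi> n t)"
      proof (rule AE_I2, rule monoI)
        fix t :: real and m n :: nat assume "m \<le> n"
        then have mn: "(real (Suc m))\<^sup>2 \<le> (real (Suc n))\<^sup>2" by (intro power_mono) auto
        have "a / (t\<^sup>2 + a) \<le> b / (t\<^sup>2 + b)" if "0 < a" "a \<le> b" for a b
        proof -
          have "t\<^sup>2 + a > 0" "t\<^sup>2 + b > 0" using that by (auto intro!: add_nonneg_pos)
          then show ?thesis using that mult_left_mono[OF that(2), of "t\<^sup>2"]
            by (simp add: frac_le_eq divide_le_0_iff algebra_simps)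
        qed
        then show "\<phi> m t \<le> \<phi> n t"
          unfolding \<phi>_def using mn u_nonneg by (intro mult_right_mono) auto
      qed
      show "AE t in lborel. (\<lambda>n. \<phi> n t) \<longlonglongrightarrow> u t"
      proof (rule AE_I2)
        fix t :: real
        have "(\<lambda>n. (real (Suc n))\<^sup>2 / (t\<^sup>2 + (real (Suc n))\<^sup>2)) \<longlonglongrightarrow> 1" by real_asymp
        from tendsto_mult[OF this tendsto_const[of "u t"]] show "(\<lambda>n. \<phi> n t) \<longlonglongrightarrow> u t"
          by (simp add: \<phi>_def)
      qed
      have "filterlim (\<lambda>n. real (Suc n) + \<epsilon>) at_top sequentially" by real_asymp
      from filterlim_compose[OF lim this]
      have "(\<lambda>n. - (real (Suc n) + \<epsilon>) * Im (G (\<i> * of_real (real (Suc n) + \<epsilon>)))) \<longlonglongrightarrow> 1" .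
      moreover have "(\<lambda>n. real (Suc n) / (real (Suc n) + \<epsilon>)) \<longlonglongrightarrow> 1" by real_asymp
      ultimately have "(\<lambda>n. real (Suc n) / (real (Suc n) + \<epsilon>)
          * (- (real (Suc n) + \<epsilon>) * Im (G (\<i> * of_real (real (Suc n) + \<epsilon>))))) \<longlonglongrightarrow> 1 * 1"
        by (intro tendsto_mult)
      moreover have "real (Suc n) / (real (Suc n) + \<epsilon>) * (- (real (Suc n) + \<epsilon>) * Im (G (\<i> * of_real (real (Suc n) + \<epsilon>))))
          = integral\<^sup>L lborel (\<phi> n)" for n
      proof -
        have cancel: "a / s * (- s * v) = - a * v" if "s > 0" for a s v :: real
          using that by simp
        have shift: "\<i> * of_real (real (Suc n)) + \<i> * of_real \<epsilon> = \<i> * of_real (real (Suc n) + \<epsilon>)"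
          by (simp add: algebra_simps)
        have "integral\<^sup>L lborel (\<phi> n) = - real (Suc n) * Im (G (\<i> * of_real (real (Suc n) + \<epsilon>)))"
          using \<phi>_int[of n] unfolding f_def shift by (rule has_bochner_integral_integral_eq)
        moreover have "real (Suc n) / (real (Suc n) + \<epsilon>) * (- (real (Suc n) + \<epsilon>) * Im (G (\<i> * of_real (real (Suc n) + \<epsilon>))))
          = - real (Suc n) * Im (G (\<i> * of_real (real (Suc n) + \<epsilon>)))"
          by (rule cancel) (use \<epsilon> in simp)
        ultimately show ?thesis by (simp only:)
      qed
      ultimately show "(\<lambda>n. integral\<^sup>L lborel (\<phi> n)) \<longlonglongrightarrow> 1" by simp
      show "u \<in> borel_measurable lborel" by simp
    qed
  qed
  define \<rho> where "\<rho> = density lborel u"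
  have \<rho>: "real_distribution \<rho>"
    unfolding \<rho>_def by (rule real_distribution_density[OF _ u_nonneg u_int]) simp
  interpret \<rho>: real_distribution \<rho> by (rule \<rho>)
  have Im_eq: "Im (cauchy_transform \<rho> z) = Im (f z)" if z: "Im z > 0" for z
  proof -
    have "Im (cauchy_transform \<rho> z) = - (LINT x|lborel. u x *\<^sub>R (Im z / (cmod (z - of_real x))\<^sup>2))"
      unfolding \<rho>.Im_cauchy_transform[OF z] unfolding \<rho>_def
      by (subst integral_density) (use u_nonneg in auto)
    also have "(\<lambda>x. u x *\<^sub>R (Im z / (cmod (z - of_real x))\<^sup>2)) = (\<lambda>x. pi * (poisson_kernel (Im z) (x - Re z) * u x))"
      by (auto simp: poisson_kernel_def cmod_power2 power2_commute[of "Re z"])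
    also have "(LINT x|lborel. pi * (poisson_kernel (Im z) (x - Re z) * u x)) = pi * (- Im (f z) / pi)"
      using poisson[OF z] by (simp only: has_bochner_integral_iff integral_mult_right_zero)
    finally show ?thesis by simp
  qed
  define D where "D = (\<lambda>z. cauchy_transform \<rho> z - f z)"
  have "D holomorphic_on upper_half_plane" unfolding D_def
    by (intro holomorphic_intros \<rho>.cauchy_transform_holomorphic holomorphic_on_subset[OF f_hol])
       (use \<epsilon> in \<open>auto simp: upper_half_plane_iff\<close>)
  then have D: "pick_function D" "Im (D z) = 0" if "Im z > 0" for z
    using Im_eq that by (auto simp: pick_function_def upper_half_plane_iff D_def)
  have D_bdd: "cmod (D z) \<le> 2 / y" if z: "Im z > 0" and y: "y > 0" for z y
  proof -
    let ?w = "\<i> * of_real y"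
    have "cmod (f ?w) \<le> 1 / Im (?w + \<i> * of_real \<epsilon>)" unfolding f_def using y \<epsilon> by (intro bdd) simp
    also have "\<dots> \<le> 1 / y" using y \<epsilon> by (intro divide_left_mono) auto
    finally have "cmod (f ?w) \<le> 1 / y" .
    moreover have "cmod (cauchy_transform \<rho> ?w) \<le> 1 / y" using \<rho>.norm_cauchy_transform_le[of ?w] y by simp
    ultimately have "cmod (D ?w) \<le> 1 / y + 1 / y"
      unfolding D_def using norm_triangle_ineq4[of "cauchy_transform \<rho> ?w" "f ?w"] by linarith
    also have "D ?w = D z" using D z y by (intro pick_Im_zero_imp_constant) auto
    finally show ?thesis by simp
  qed
  have "D z = 0" if z: "Im z > 0" for z
  proof (rule ccontr)
    assume "D z \<noteq> 0"
    then show False using D_bdd[OF z, of "4 / cmod (D z)"] by simp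
  qed
  then show ?thesis using \<rho> by (auto simp: D_def f_def)
qed

text \<open>
  Outside the interval, \<open>y\<^sup>2 / (x\<^sup>2 + y\<^sup>2)\<close> is at most one half.
\<close>

lemma (in real_distribution) measure_interval_ge:
  assumes y: "y > 0"
  shows "measure M {-y<..y} \<ge> 1 - 2 * (1 + y * Im (cauchy_transform M (\<i> * of_real y)))"
proof -
  define k where "k = (\<lambda>x. y\<^sup>2 / (x\<^sup>2 + y\<^sup>2))"
  have k: "0 \<le> k x" "k x \<le> 1" for x using y by (auto simp: k_def divide_le_eq_1 add_nonneg_pos)
  have [measurable]: "k \<in> borel_measurable borel" unfolding k_def by measurable
  have int: "integrable M k" by (rule integrable_const_bound[where B=1]) (use k in auto)
  have ind: "integrable M (indicator (space M - {-y<..y}) :: real \<Rightarrow> real)"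
    by (rule integrable_const_bound[where B=1]) (auto simp: indicator_def)
  have "1 - measure M {-y<..y} = measure M (space M - {-y<..y})"
    by (subst prob_compl) auto
  also have "\<dots> = expectation (indicator (space M - {-y<..y}))" by simp
  also have "\<dots> \<le> expectation (\<lambda>x. 2 * (1 - k x))"
  proof (rule integral_mono)
    fix x
    show "indicator (space M - {-y<..y}) x \<le> 2 * (1 - k x)"
    proof (cases "x \<in> {-y<..y}")
      case False
      then have "y\<^sup>2 \<le> x\<^sup>2" using y by (intro abs_le_square_iff[THEN iffD1]) auto
      then have "k x \<le> 1 / 2" using y by (simp add: k_def divide_le_eq add_nonneg_pos)
      then have "1 \<le> 2 * (1 - k x)" by simp
      then show ?thesis by (rule order_trans[rotated]) (simp add: indicator_def)
    qed (use k in simp)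
  qed (use int ind in simp_all)
  also have "\<dots> = 2 * (1 + y * Im (cauchy_transform M (\<i> * of_real y)))"
    using int integral_eq_Im_cauchy_transform[OF y, folded k_def] prob_space by simp
  finally show ?thesis by simp
qed

text \<open>
  The measures with Cauchy transforms \<open>G(z + i\<epsilon>\<^sub>n)\<close> are tight: their mass near the origin is
  controlled by \<open>- y Im G(i(y + \<epsilon>\<^sub>n))\<close>, which is close to 1 for large \<open>y\<close>, uniformly in \<open>\<epsilon>\<^sub>n \<le> 1\<close>.  The
  resolvent is bounded and continuous, so along a weakly convergent subsequence the Cauchy transforms
  converge to that of the limit.
\<close>

theorem F_transform_surj:
  assumes F: "F \<in> F_class"
  shows "\<exists>\<rho>. real_distribution \<rho> \<and> (\<forall>z\<in>upper_half_plane. F_transform \<rho> z = F z)"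
proof -
  define G where "G = (\<lambda>z. 1 / F z)"
  have F_ne: "F z \<noteq> 0" if "Im z > 0" for z using F_class_Im_ge(2)[OF F that] by auto
  have G_hol: "G holomorphic_on upper_half_plane"
    unfolding G_def using F F_ne by (intro holomorphic_intros) (auto simp: F_class_def upper_half_plane_iff)
  have G_bdd: "cmod (G z) \<le> 1 / Im z" if z: "Im z > 0" for z
  proof -
    have "Im z \<le> cmod (F z)" using F_class_Im_ge(1)[OF F z] abs_Im_le_cmod[of "F z"] by linarith
    then show ?thesis using z by (simp add: G_def norm_divide frac_le)
  qed
  have G_neg: "Im (G z) \<le> 0" if z: "Im z > 0" for z
    using F_class_Im_ge(2)[OF F z] by (simp add: G_def Im_divide' divide_le_0_iff)
  have G_lim: "((\<lambda>y. - y * Im (G (\<i> * of_real y))) \<longlongrightarrow> 1) at_top"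
  proof (rule Lim_transform_eventually)
    show "((\<lambda>y. - Im (1 / (F (\<i> * of_real y) / of_real y))) \<longlongrightarrow> 1) at_top"
      by (rule tendsto_eq_rhs[OF tendsto_minus[OF tendsto_Im[OF tendsto_divide[OF tendsto_const F_class_tendsto[OF F]]]]]) auto
    show "eventually (\<lambda>y. - Im (1 / (F (\<i> * of_real y) / of_real y)) = - y * Im (G (\<i> * of_real y))) at_top"
    proof (rule always_eventually, rule allI)
      fix y
      have "1 / (F (\<i> * of_real y) / of_real y) = of_real y * G (\<i> * of_real y)" by (simp add: G_def)
      then show "- Im (1 / (F (\<i> * of_real y) / of_real y)) = - y * Im (G (\<i> * of_real y))" by simp
    qed
  qed
  define \<epsilon> where "\<epsilon> = (\<lambda>n::nat. 1 / real (Suc n))"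
  have \<epsilon>: "\<epsilon> n > 0" "\<epsilon> n \<le> 1" for n by (simp_all add: \<epsilon>_def)
  have \<epsilon>0: "\<epsilon> \<longlonglongrightarrow> 0" unfolding \<epsilon>_def by (intro LIMSEQ_Suc lim_1_over_n)
  obtain \<rho> where \<rho>: "\<And>n. real_distribution (\<rho> n)"
      and G_\<rho>: "\<And>n z. Im z > 0 \<Longrightarrow> cauchy_transform (\<rho> n) z = G (z + \<i> * of_real (\<epsilon> n))"
    using shifted_function_is_cauchy_transform[OF G_hol G_bdd G_neg G_lim \<epsilon>(1)] by metis
  have "tight \<rho>"
    unfolding tight_def
  proof (intro conjI allI impI)
    fix \<eta> :: real assume \<eta>: "\<eta> > 0"
    have "eventually (\<lambda>s. - s * Im (G (\<i> * of_real s)) > 1 - \<eta> / 8) at_top"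
      by (rule order_tendstoD(1)[OF G_lim]) (use \<eta> in simp)
    then obtain Y where Y: "\<And>s. s \<ge> Y \<Longrightarrow> - s * Im (G (\<i> * of_real s)) > 1 - \<eta> / 8"
      by (auto simp: eventually_at_top_linorder)
    define y where "y = max (max Y 1) (8 / \<eta>)"
    have y: "y \<ge> Y" "y > 0" "1 / y \<le> \<eta> / 8"
    proof -
      show "y \<ge> Y" "y > 0" by (auto simp: y_def)
      have "y \<ge> 8 / \<eta>" by (simp add: y_def)
      then show "1 / y \<le> \<eta> / 8" using \<eta> \<open>y > 0\<close> by (simp add: field_simps)
    qed
    have "measure (\<rho> n) {-y<..y} > 1 - \<eta>" for n
    proof -
      define s where "s = y + \<epsilon> n"
      define g where "g = - Im (G (\<i> * of_real s))"
      have s: "s \<ge> Y" "s > 0" "s \<ge> y" using y \<epsilon>[of n] by (auto simp: s_def)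
      have "s * g > 1 - \<eta> / 8" using Y[OF s(1)] by (simp add: g_def)
      moreover have "g \<le> 1 / y"
      proof -
        have "g \<le> cmod (G (\<i> * of_real s))" using abs_Im_le_cmod[of "G (\<i> * of_real s)"] by (simp add: g_def)
        also have "\<dots> \<le> 1 / s" using G_bdd[of "\<i> * of_real s"] s by simp
        also have "\<dots> \<le> 1 / y" using s y by (intro divide_left_mono) auto
        finally show ?thesis .
      qed
      moreover have "g \<ge> 0" using G_neg[of "\<i> * of_real s"] s by (simp add: g_def)
      then have "\<epsilon> n * g \<le> 1 * g" using \<epsilon>[of n] by (intro mult_right_mono) auto
      moreover have "s * g = y * g + \<epsilon> n * g" by (simp add: s_def algebra_simps)
      ultimately have "y * g > 1 - \<eta> / 4" using y by linarith
      moreover have "\<i> * of_real y + \<i> * of_real (\<epsilon> n) = \<i> * of_real s" by (simp add: s_def algebra_simps)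
      then have "Im (cauchy_transform (\<rho> n) (\<i> * of_real y)) = - g"
        using G_\<rho>[of "\<i> * of_real y" n] y by (simp add: g_def)
      ultimately show ?thesis
        using real_distribution.measure_interval_ge[OF \<rho>[of n] y(2)] \<eta> by simp
    qed
    moreover have "-y < y" using y by simp
    ultimately show "\<exists>a b. a < b \<and> (\<forall>n. measure (\<rho> n) {a<..b} > 1 - \<eta>)" by blast
  qed (rule \<rho>)
  from tight_imp_convergent_subsubsequence[OF this strict_mono_id]
  obtain r \<rho>' where r: "strict_mono r" and \<rho>': "real_distribution \<rho>'" and conv: "weak_conv_m (\<rho> \<circ> id \<circ> r) \<rho>'"
    by blast
  have "cauchy_transform \<rho>' z = G z" if z: "Im z > 0" for z
  proof (rule LIMSEQ_unique)
    have "(\<lambda>n. integral\<^sup>L ((\<rho> \<circ> id \<circ> r) n) (\<lambda>x. 1 / (z - complex_of_real x))) \<longlonglongrightarrow>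
        integral\<^sup>L \<rho>' (\<lambda>x. 1 / (z - complex_of_real x))"
    proof (rule weak_conv_imp_integral_bdd_continuous_conv[OF _ \<rho>' conv])
      show "real_distribution ((\<rho> \<circ> id \<circ> r) n)" for n using \<rho> by simp
      show "isCont (\<lambda>x. 1 / (z - complex_of_real x)) x" for x
        using resolvent_ne_0[OF z] by (intro continuous_intros) auto
      show "norm (1 / (z - complex_of_real x)) \<le> 1 / Im z" for x
        by (rule norm_resolvent_le[OF z])
    qed
    then have "(\<lambda>n. cauchy_transform (\<rho> (r n)) z) \<longlonglongrightarrow> cauchy_transform \<rho>' z"
      by (simp add: cauchy_transform_def)
    then show "(\<lambda>n. G (z + \<i> * of_real (\<epsilon> (r n)))) \<longlonglongrightarrow> cauchy_transform \<rho>' z"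
      by (simp add: G_\<rho>[OF z])
    have "isCont G z"
      using holomorphic_on_imp_continuous_on[OF G_hol] z
      by (simp add: continuous_on_eq_continuous_at[OF open_upper_half_plane] upper_half_plane_iff)
    moreover have "(\<lambda>n. z + \<i> * of_real (\<epsilon> (r n))) \<longlonglongrightarrow> z + \<i> * of_real 0"
      using LIMSEQ_subseq_LIMSEQ[OF \<epsilon>0 r] by (intro tendsto_intros) (simp add: o_def)
    ultimately show "(\<lambda>n. G (z + \<i> * of_real (\<epsilon> (r n)))) \<longlonglongrightarrow> G z"
      using isCont_tendsto_compose[of z G] by simp
  qed
  then show ?thesis
    using \<rho>' F_ne by (intro exI[of _ \<rho>']) (auto simp: F_transform_def G_def upper_half_plane_iff)
qed

section \<open>The three convolutions\<close>

lemma ex1_measure_with_F_transform: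
  assumes "F \<in> F_class"
  shows "\<exists>!\<rho>. real_distribution \<rho> \<and> (\<forall>z\<in>upper_half_plane. F_transform \<rho> z = F z)"
proof -
  obtain \<rho> where \<rho>: "real_distribution \<rho>" "\<forall>z\<in>upper_half_plane. F_transform \<rho> z = F z"
    using F_transform_surj[OF assms] by blast
  show ?thesis
  proof (rule ex1I[of _ \<rho>])
    show "real_distribution \<rho> \<and> (\<forall>z\<in>upper_half_plane. F_transform \<rho> z = F z)" using \<rho> by blast
    show "\<sigma> = \<rho>" if "real_distribution \<sigma> \<and> (\<forall>z\<in>upper_half_plane. F_transform \<sigma> z = F z)" for \<sigma>
      using that \<rho> by (intro F_transform_inj) simp_all
  qed
qed

lemma F_class_F_transform: "real_distribution \<mu> \<Longrightarrow> F_transform \<mu> \<in> F_class"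
  by (rule real_distribution.F_transform_in_F_class)

lemma
  assumes "real_distribution \<mu>" "real_distribution \<nu>"
  shows real_distribution_monotone: "real_distribution (monotone_convolution \<mu> \<nu>)"
    and F_transform_monotone: "z \<in> upper_half_plane \<Longrightarrow>
      F_transform (monotone_convolution \<mu> \<nu>) z = F_transform \<mu> (F_transform \<nu> z)"
  using theI'[OF ex1_measure_with_F_transform[OF F_class_compose[OF
      F_class_F_transform[OF assms(1)] F_class_F_transform[OF assms(2)]]]]
  unfolding monotone_convolution_def by blast+

lemma
  assumes "real_distribution \<mu>" "real_distribution \<nu>"
  shows real_distribution_boolean: "real_distribution (boolean_convolution \<mu> \<nu>)"
    and F_transform_boolean: "z \<in> upper_half_plane \<Longrightarrow>
      F_transform (boolean_convolution \<mu> \<nu>) z = F_transform \<mu> z + F_transform \<nu> z - z"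
  using theI'[OF ex1_measure_with_F_transform[OF F_class_boolean[OF
      F_class_F_transform[OF assms(1)] F_class_F_transform[OF assms(2)]]]]
  unfolding boolean_convolution_def by blast+

lemma subordination_functions_iff:
  "subordination_functions \<mu> \<nu> Z1 Z2 \<longleftrightarrow>
    Z1 \<in> F_class \<and> Z2 \<in> F_class \<and> subordinating (F_transform \<mu>) (F_transform \<nu>) Z1 Z2"
  by (simp add: subordination_functions_def subordinating_def)

text \<open>
  By uniqueness of the subordination functions, any one solution may stand for the existentially
  quantified one in the definition of the free convolution.
\<close>

lemma
  assumes \<mu>: "real_distribution \<mu>" and \<nu>: "real_distribution \<nu>"
    and Z: "subordination_functions \<mu> \<nu> Z1 Z2"
  shows real_distribution_free: "real_distribution (free_convolution \<mu> \<nu>)"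
    and F_transform_free: "z \<in> upper_half_plane \<Longrightarrow>
      F_transform (free_convolution \<mu> \<nu>) z = F_transform \<mu> (Z1 z)"
proof -
  let ?P = "\<lambda>\<rho>. real_distribution \<rho> \<and> (\<exists>Z1 Z2. subordination_functions \<mu> \<nu> Z1 Z2 \<and>
        (\<forall>z\<in>upper_half_plane. F_transform \<rho> z = F_transform \<mu> (Z1 z) \<and>
           F_transform \<rho> z = F_transform \<nu> (Z2 z)))"
  let ?Q = "\<lambda>\<rho>. real_distribution \<rho> \<and> (\<forall>z\<in>upper_half_plane. F_transform \<rho> z = F_transform \<mu> (Z1 z))"
  have "Z1 \<in> F_class" using Z by (simp add: subordination_functions_def)
  then have ex1: "\<exists>!\<rho>. ?Q \<rho>"
    by (rule ex1_measure_with_F_transform[OF F_class_compose[OF F_class_F_transform[OF \<mu>]]])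
  have "?P = ?Q"
  proof (intro ext iffI)
    fix \<rho>
    assume "?P \<rho>"
    then obtain W1 W2 where W: "real_distribution \<rho>" "subordination_functions \<mu> \<nu> W1 W2"
        "\<forall>z\<in>upper_half_plane. F_transform \<rho> z = F_transform \<mu> (W1 z)" by blast
    have "Z1 z = W1 z" if "z \<in> upper_half_plane" for z
      using subordinating_unique[OF F_class_F_transform[OF \<mu>] F_class_F_transform[OF \<nu>], of Z1 Z2 W1 W2 z] Z W(2) that
      by (simp add: subordination_functions_iff)
    then show "?Q \<rho>" using W by simp
  next
    fix \<rho>
    assume "?Q \<rho>"
    then show "?P \<rho>" using Z by (intro conjI exI[of _ Z1] exI[of _ Z2]) (auto simp: subordination_functions_def)
  qed
  then have "free_convolution \<mu> \<nu> = (THE \<rho>. ?Q \<rho>)" unfolding free_convolution_def by (rule arg_cong)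
  then show "real_distribution (free_convolution \<mu> \<nu>)"
    "z \<in> upper_half_plane \<Longrightarrow> F_transform (free_convolution \<mu> \<nu>) z = F_transform \<mu> (Z1 z)"
    using theI'[OF ex1] by simp_all
qed

theorem theorem5p1:
  fixes \<mu> \<nu> :: "real measure"
  assumes "real_distribution \<mu>" and "real_distribution \<nu>"
  shows "\<exists>!(\<zeta>1, \<zeta>2).
           real_distribution \<zeta>1 \<and> real_distribution \<zeta>2 \<and>
           free_convolution \<mu> \<nu> = monotone_convolution \<mu> \<zeta>1 \<and>
           monotone_convolution \<mu> \<zeta>1 = monotone_convolution \<nu> \<zeta>2 \<and>
           monotone_convolution \<nu> \<zeta>2 = boolean_convolution \<zeta>1 \<zeta>2"
proof -
  note \<mu> = assms(1) and \<nu> = assms(2)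
  note F_\<mu> = F_class_F_transform[OF \<mu>] and F_\<nu> = F_class_F_transform[OF \<nu>]
  obtain Z1 Z2 where Z: "Z1 \<in> F_class" "Z2 \<in> F_class" "subordinating (F_transform \<mu>) (F_transform \<nu>) Z1 Z2"
    using subordinating_exists[OF F_\<mu> F_\<nu>] by blast
  have sub: "subordination_functions \<mu> \<nu> Z1 Z2" using Z by (simp add: subordination_functions_iff)
  obtain \<zeta>1 where \<zeta>1: "real_distribution \<zeta>1" "\<And>z. z \<in> upper_half_plane \<Longrightarrow> F_transform \<zeta>1 z = Z1 z"
    using F_transform_surj[OF Z(1)] by blast
  obtain \<zeta>2 where \<zeta>2: "real_distribution \<zeta>2" "\<And>z. z \<in> upper_half_plane \<Longrightarrow> F_transform \<zeta>2 z = Z2 z"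
    using F_transform_surj[OF Z(2)] by blast
  have eqs: "F_transform \<mu> (Z1 z) = F_transform \<nu> (Z2 z)" "F_transform \<nu> (Z2 z) = Z1 z + Z2 z - z"
    if "z \<in> upper_half_plane" for z
    using Z(3) that by (auto simp: subordinating_def)
  have "free_convolution \<mu> \<nu> = monotone_convolution \<mu> \<zeta>1"
    by (rule F_transform_inj[OF real_distribution_free[OF \<mu> \<nu> sub] real_distribution_monotone[OF \<mu> \<zeta>1(1)]])
       (simp add: F_transform_free[OF \<mu> \<nu> sub] F_transform_monotone[OF \<mu> \<zeta>1(1)] \<zeta>1(2))
  moreover have "monotone_convolution \<mu> \<zeta>1 = monotone_convolution \<nu> \<zeta>2"
    by (rule F_transform_inj[OF real_distribution_monotone[OF \<mu> \<zeta>1(1)] real_distribution_monotone[OF \<nu> \<zeta>2(1)]])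
       (simp add: F_transform_monotone[OF \<mu> \<zeta>1(1)] F_transform_monotone[OF \<nu> \<zeta>2(1)] \<zeta>1(2) \<zeta>2(2) eqs(1))
  moreover have "monotone_convolution \<nu> \<zeta>2 = boolean_convolution \<zeta>1 \<zeta>2"
    by (rule F_transform_inj[OF real_distribution_monotone[OF \<nu> \<zeta>2(1)] real_distribution_boolean[OF \<zeta>1(1) \<zeta>2(1)]])
       (simp add: F_transform_monotone[OF \<nu> \<zeta>2(1)] F_transform_boolean[OF \<zeta>1(1) \<zeta>2(1)] \<zeta>1(2) \<zeta>2(2) eqs(2))
  ultimately have ex: "real_distribution \<zeta>1 \<and> real_distribution \<zeta>2 \<and>
      free_convolution \<mu> \<nu> = monotone_convolution \<mu> \<zeta>1 \<and>
      monotone_convolution \<mu> \<zeta>1 = monotone_convolution \<nu> \<zeta>2 \<and>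
      monotone_convolution \<nu> \<zeta>2 = boolean_convolution \<zeta>1 \<zeta>2"
    using \<zeta>1(1) \<zeta>2(1) by (intro conjI)
  \<comment> \<open>The equality of the two monotone convolutions and the boolean one is the subordination system for the transforms.\<close>
  have uniq: "\<eta>1 = \<zeta>1 \<and> \<eta>2 = \<zeta>2"
    if \<eta>: "real_distribution \<eta>1" "real_distribution \<eta>2"
      and eq: "monotone_convolution \<mu> \<eta>1 = monotone_convolution \<nu> \<eta>2"
        "monotone_convolution \<nu> \<eta>2 = boolean_convolution \<eta>1 \<eta>2" for \<eta>1 \<eta>2
  proof -
    have "subordinating (F_transform \<mu>) (F_transform \<nu>) (F_transform \<eta>1) (F_transform \<eta>2)"
      unfolding subordinating_def
    proof (intro ballI conjI)
      fix z assume z: "z \<in> upper_half_plane"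
      show "F_transform \<mu> (F_transform \<eta>1 z) = F_transform \<nu> (F_transform \<eta>2 z)"
        using F_transform_monotone[OF \<mu> \<eta>(1) z] F_transform_monotone[OF \<nu> \<eta>(2) z] eq(1) by simp
      show "F_transform \<nu> (F_transform \<eta>2 z) = F_transform \<eta>1 z + F_transform \<eta>2 z - z"
        using F_transform_boolean[OF \<eta> z] F_transform_monotone[OF \<nu> \<eta>(2) z] eq(2) by simp
    qed
    from subordinating_unique[OF F_\<mu> F_\<nu> F_class_F_transform[OF \<eta>(1)] F_class_F_transform[OF \<eta>(2)] this Z]
    have "F_transform \<eta>1 z = F_transform \<zeta>1 z \<and> F_transform \<eta>2 z = F_transform \<zeta>2 z"
      if "z \<in> upper_half_plane" for z
      unfolding \<zeta>1(2)[OF that] \<zeta>2(2)[OF that] using that .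
    then show ?thesis
      using F_transform_inj[OF \<eta>(1) \<zeta>1(1)] F_transform_inj[OF \<eta>(2) \<zeta>2(1)] by simp
  qed

  show ?thesis
  proof (rule ex1I[of _ "(\<zeta>1, \<zeta>2)"])
    show "case (\<zeta>1, \<zeta>2) of (\<zeta>1, \<zeta>2) \<Rightarrow> real_distribution \<zeta>1 \<and> real_distribution \<zeta>2 \<and>
      free_convolution \<mu> \<nu> = monotone_convolution \<mu> \<zeta>1 \<and>
      monotone_convolution \<mu> \<zeta>1 = monotone_convolution \<nu> \<zeta>2 \<and>
      monotone_convolution \<nu> \<zeta>2 = boolean_convolution \<zeta>1 \<zeta>2"
      unfolding prod.case by (rule ex)
  next
    fix p :: "real measure \<times> real measure"
    obtain \<eta>1 \<eta>2 where p: "p = (\<eta>1, \<eta>2)" by (cases p)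
    assume "case p of (\<zeta>1, \<zeta>2) \<Rightarrow> real_distribution \<zeta>1 \<and> real_distribution \<zeta>2 \<and>
      free_convolution \<mu> \<nu> = monotone_convolution \<mu> \<zeta>1 \<and>
      monotone_convolution \<mu> \<zeta>1 = monotone_convolution \<nu> \<zeta>2 \<and>
      monotone_convolution \<nu> \<zeta>2 = boolean_convolution \<zeta>1 \<zeta>2"
    then have "\<eta>1 = \<zeta>1 \<and> \<eta>2 = \<zeta>2" unfolding p prod.case by (elim conjE) (rule uniq)
    then show "p = (\<zeta>1, \<zeta>2)" unfolding p by simp
  qed
qed

end
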